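(* Let $m > 1$ be a natural number. For every integer $i > 1$ the following isomorphisms of groups hold: 1) $\gamma_i\left(BS(m,m)\right) \cong \gamma_i(\mathbb{Z} * \mathbb{Z}_m)$; 2) $\gamma_i\left(BS(m,-m)\right) \cong \langle a^{2^{i-1}m} \rangle \times \gamma_i(\mathbb{Z} * \mathbb{Z}_m)$, where $\langle a^{2^{i-1}m}\rangle$ is the cyclic subgroup of $BS(m,-m)$ generated by $a^{2^{i-1}m}$.
   Context: For non-zero integers $m,n$, the Baumslag-Solitar group is $BS(m,n) = \langle\, a, t \mid t^{-1} a^m t = a^n \,\rangle$. For a group $G$, the lower central series is defined by $\gamma_1 G = G$ and $\gamma_{i+1} G = [\gamma_i G, G]$ for $i \geq 1$, where $[A,B]$ denotes the subgroup generated by all commutators $[x,y] = x^{-1}y^{-1}xy$ with $x \in A$, $y \in B$. $\mathbb{Z}_m$ is the cyclic group of order $m$, and $*$ denotes the free product of groups. *)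

theory Defs
  imports "HOL-Algebra.Elementary_Groups"
begin

section \<open>Quotients of word monoids\<close>

inductive_set word_cong :: "'l set \<Rightarrow> ('l list \<times> 'l list) set \<Rightarrow> ('l list \<times> 'l list) set"
  for L :: "'l set" and R :: "('l list \<times> 'l list) set"
where
  refl: "w \<in> lists L \<Longrightarrow> (w, w) \<in> word_cong L R"
| sym: "(u, v) \<in> word_cong L R \<Longrightarrow> (v, u) \<in> word_cong L R"
| trans: "(u, v) \<in> word_cong L R \<Longrightarrow> (v, w) \<in> word_cong L R \<Longrightarrow> (u, w) \<in> word_cong L R"
| rel: "(u, v) \<in> R \<Longrightarrow> u \<in> lists L \<Longrightarrow> v \<in> lists L \<Longrightarrow> p \<in> lists L \<Longrightarrow> q \<in> lists L
    \<Longrightarrow> (p @ u @ q, p @ v @ q) \<in> word_cong L R"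

definition word_class :: "'l set \<Rightarrow> ('l list \<times> 'l list) set \<Rightarrow> 'l list \<Rightarrow> 'l list set"
  where "word_class L R w = word_cong L R `` {w}"

definition word_quotient :: "'l set \<Rightarrow> ('l list \<times> 'l list) set \<Rightarrow> 'l list set monoid"
  where "word_quotient L R =
    \<lparr>carrier = lists L // word_cong L R,
     monoid.mult = (\<lambda>U V. \<Union>u\<in>U. \<Union>v\<in>V. word_class L R (u @ v)),
     one = word_class L R []\<rparr>"

lemma word_cong_lists: "(u, v) \<in> word_cong L R \<Longrightarrow> u \<in> lists L \<and> v \<in> lists L"
  by (induction rule: word_cong.induct) auto

lemma equiv_word_cong: "equiv (lists L) (word_cong L R)"
proof (rule equivI)
  show "word_cong L R \<subseteq> lists L \<times> lists L"
  proof (rule subrelI)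
    fix u v assume "(u, v) \<in> word_cong L R"
    from word_cong_lists[OF this] show "(u, v) \<in> lists L \<times> lists L"
      by (rule conjE) (rule SigmaI)
  qed
  show "refl_on (lists L) (word_cong L R)"
    by (rule refl_onI) (rule word_cong.refl)
  show "sym (word_cong L R)"
    by (rule symI) (rule word_cong.sym)
  show "trans (word_cong L R)"
    by (rule transI) (rule word_cong.trans)
qed

lemma word_cong_context:
  assumes "(u, v) \<in> word_cong L R" "p \<in> lists L" "q \<in> lists L"
  shows "(p @ u @ q, p @ v @ q) \<in> word_cong L R"
  using assms
proof (induction rule: word_cong.induct)
  case (refl w)
  then show ?case by (intro word_cong.refl) auto
next
  case (sym u v)
  show ?case by (rule word_cong.sym) (rule sym.IH[OF sym.prems])
next
  case (trans u v w)
  show ?case by (rule word_cong.trans) (rule trans.IH(1)[OF trans.prems], rule trans.IH(2)[OF trans.prems])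
next
  case (rel u v p' q')
  have "((p @ p') @ u @ (q' @ q), (p @ p') @ v @ (q' @ q)) \<in> word_cong L R"
    using rel by (intro word_cong.rel) auto
  then show ?case by simp
qed

lemma word_cong_base:
  "(u, v) \<in> R \<Longrightarrow> u \<in> lists L \<Longrightarrow> v \<in> lists L \<Longrightarrow> (u, v) \<in> word_cong L R"
  using word_cong.rel[of u v R L "[]" "[]"] by simp

lemma word_cong_append:
  assumes "(u, u') \<in> word_cong L R" "(v, v') \<in> word_cong L R"
  shows "(u @ v, u' @ v') \<in> word_cong L R"
proof -
  have L: "v \<in> lists L" "u' \<in> lists L"
    using assms word_cong_lists by blast+
  have "(u @ v, u' @ v) \<in> word_cong L R"
    using word_cong_context[OF assms(1), of "[]" v] L by simp
  moreover have "(u' @ v, u' @ v') \<in> word_cong L R"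
    using word_cong_context[OF assms(2), of u' "[]"] L by simp
  ultimately show ?thesis by (rule word_cong.trans)
qed

lemma word_class_eq_iff:
  assumes "u \<in> lists L" "v \<in> lists L"
  shows "word_class L R u = word_class L R v \<longleftrightarrow> (u, v) \<in> word_cong L R"
  unfolding word_class_def using eq_equiv_class_iff[OF equiv_word_cong assms] .

lemma carrier_word_quotient: "carrier (word_quotient L R) = word_class L R ` lists L"
  by (auto simp: word_quotient_def word_class_def quotient_def)

lemma one_word_quotient: "\<one>\<^bsub>word_quotient L R\<^esub> = word_class L R []"
  by (simp add: word_quotient_def)

lemma mult_word_quotient:
  assumes "u \<in> lists L" "v \<in> lists L"
  shows "word_class L R u \<otimes>\<^bsub>word_quotient L R\<^esub> word_class L R v = word_class L R (u @ v)"
proof -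
  have "word_class L R (u' @ v') = word_class L R (u @ v)"
    if "u' \<in> word_class L R u" "v' \<in> word_class L R v" for u' v'
  proof -
    have *: "(u, u') \<in> word_cong L R" "(v, v') \<in> word_cong L R"
      using that by (auto simp: word_class_def)
    then have "u' \<in> lists L" "v' \<in> lists L"
      using word_cong_lists by blast+
    then show ?thesis
      using word_cong.sym[OF word_cong_append[OF *]] assms by (simp add: word_class_eq_iff)
  qed
  then have "(\<Union>u'\<in>word_class L R u. \<Union>v'\<in>word_class L R v. word_class L R (u' @ v'))
      = (\<Union>u'\<in>word_class L R u. \<Union>v'\<in>word_class L R v. word_class L R (u @ v))"
    by (intro SUP_cong HOL.refl)
  moreover have "word_class L R u \<noteq> {}" "word_class L R v \<noteq> {}"
    using word_cong.refl[OF assms(1)] word_cong.refl[OF assms(2)]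
    unfolding word_class_def by blast+
  ultimately show ?thesis
    by (simp add: word_quotient_def)
qed

lemma group_word_quotient:
  assumes inv: "\<And>x. x \<in> L \<Longrightarrow> \<exists>w \<in> lists L. (w @ [x], []) \<in> word_cong L R"
  shows "group (word_quotient L R)"
proof (rule groupI)
  let ?Q = "word_quotient L R"
  have rep: "\<exists>w \<in> lists L. x = word_class L R w" if "x \<in> carrier ?Q" for x
    using that unfolding carrier_word_quotient by blast
  have closed: "word_class L R w \<in> carrier ?Q" if "w \<in> lists L" for w
    using that unfolding carrier_word_quotient by blast
  show "\<one>\<^bsub>?Q\<^esub> \<in> carrier ?Q"
    using closed[of "[]"] by (simp add: one_word_quotient)
  show "x \<otimes>\<^bsub>?Q\<^esub> y \<in> carrier ?Q" if xy: "x \<in> carrier ?Q" "y \<in> carrier ?Q" for x y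
  proof -
    obtain u v where "u \<in> lists L" "x = word_class L R u" "v \<in> lists L" "y = word_class L R v"
      using rep[OF xy(1)] rep[OF xy(2)] by blast
    then show ?thesis
      using closed[of "u @ v"] by (simp add: mult_word_quotient)
  qed
  show "x \<otimes>\<^bsub>?Q\<^esub> y \<otimes>\<^bsub>?Q\<^esub> z = x \<otimes>\<^bsub>?Q\<^esub> (y \<otimes>\<^bsub>?Q\<^esub> z)"
    if xyz: "x \<in> carrier ?Q" "y \<in> carrier ?Q" "z \<in> carrier ?Q" for x y z
  proof -
    obtain u v w where "u \<in> lists L" "x = word_class L R u" "v \<in> lists L" "y = word_class L R v"
      "w \<in> lists L" "z = word_class L R w"
      using rep[OF xyz(1)] rep[OF xyz(2)] rep[OF xyz(3)] by blast
    then show ?thesis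
      by (simp add: mult_word_quotient)
  qed
  show "\<one>\<^bsub>?Q\<^esub> \<otimes>\<^bsub>?Q\<^esub> x = x" if x: "x \<in> carrier ?Q" for x
  proof -
    obtain u where "u \<in> lists L" "x = word_class L R u"
      using rep[OF x] by blast
    then show ?thesis
      by (simp add: mult_word_quotient one_word_quotient)
  qed
  have left_inv: "\<exists>w' \<in> lists L. (w' @ w, []) \<in> word_cong L R" if "w \<in> lists L" for w
    using that
  proof (induction w)
    case Nil
    then show ?case by (auto intro!: bexI[of _ "[]"] word_cong.refl)
  next
    case (Cons x w)
    obtain v where v: "v \<in> lists L" "(v @ [x], []) \<in> word_cong L R"
      using inv Cons.hyps by blast
    obtain w' where w': "w' \<in> lists L" "(w' @ w, []) \<in> word_cong L R"
      using Cons.IH by blast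
    have "((w' @ v) @ x # w, w' @ w) \<in> word_cong L R"
      using word_cong_context[OF v(2) w'(1) Cons.hyps(2)] by simp
    then have "((w' @ v) @ x # w, []) \<in> word_cong L R"
      using w'(2) by (rule word_cong.trans)
    then show ?case
      using v(1) w'(1) by (intro bexI[of _ "w' @ v"]) auto
  qed
  fix x assume "x \<in> carrier (word_quotient L R)"
  then obtain w where w: "w \<in> lists L" "x = word_class L R w"
    by (auto simp only: carrier_word_quotient)
  obtain w' where w': "w' \<in> lists L" "(w' @ w, []) \<in> word_cong L R"
    using left_inv[OF w(1)] by blast
  have "word_class L R (w' @ w) = word_class L R []"
    using w w' by (simp add: word_class_eq_iff)
  then have "word_class L R w' \<otimes>\<^bsub>word_quotient L R\<^esub> x = \<one>\<^bsub>word_quotient L R\<^esub>"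
    using w w' by (simp add: one_word_quotient mult_word_quotient)
  then show "\<exists>y \<in> carrier (word_quotient L R). y \<otimes>\<^bsub>word_quotient L R\<^esub> x = \<one>\<^bsub>word_quotient L R\<^esub>"
    using w'(1) unfolding carrier_word_quotient by blast
qed


section \<open>Group presentations\<close>

text \<open>The letter \<open>(x, True)\<close> stands for the generator \<open>x\<close> and \<open>(x, False)\<close> for its formal inverse.
  A relation \<open>u = v\<close> is given as the pair \<open>(u, v)\<close>.\<close>

definition letters :: "'x set \<Rightarrow> ('x \<times> bool) set"
  where "letters X = X \<times> UNIV"

definition cancellation :: "'x set \<Rightarrow> (('x \<times> bool) list \<times> ('x \<times> bool) list) set"
  where "cancellation X = {([(x, b), (x, \<not> b)], []) | x b. x \<in> X}"

definition presented_group ::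
    "'x set \<Rightarrow> (('x \<times> bool) list \<times> ('x \<times> bool) list) set \<Rightarrow> ('x \<times> bool) list set monoid"
  where "presented_group X R = word_quotient (letters X) (cancellation X \<union> R)"

definition presented_elem ::
    "'x set \<Rightarrow> (('x \<times> bool) list \<times> ('x \<times> bool) list) set \<Rightarrow> ('x \<times> bool) list \<Rightarrow> ('x \<times> bool) list set"
  where "presented_elem X R w = word_class (letters X) (cancellation X \<union> R) w"

definition power_word :: "'x \<Rightarrow> int \<Rightarrow> ('x \<times> bool) list"
  where "power_word x k = replicate (nat \<bar>k\<bar>) (x, k \<ge> 0)"

lemma group_presented_group: "group (presented_group X R)"
  unfolding presented_group_def
proof (rule group_word_quotient)
  fix l assume "l \<in> letters X"
  then obtain x b where l: "l = (x, b)" "x \<in> X"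
    by (auto simp: letters_def)
  have "([(x, \<not> b), (x, b)], []) \<in> word_cong (letters X) (cancellation X \<union> R)"
  proof (rule word_cong_base)
    show "([(x, \<not> b), (x, b)], []) \<in> cancellation X \<union> R"
      unfolding cancellation_def using l(2) by simp
  qed (use l(2) in \<open>simp_all add: letters_def\<close>)
  then show "\<exists>w \<in> lists (letters X). (w @ [l], []) \<in> word_cong (letters X) (cancellation X \<union> R)"
    using l by (intro bexI[of _ "[(x, \<not> b)]"]) (simp_all add: letters_def)
qed


section \<open>Baumslag-Solitar groups\<close>

datatype BS_generator = BS_a | BS_t

definition BS_relations ::
    "int \<Rightarrow> int \<Rightarrow> ((BS_generator \<times> bool) list \<times> (BS_generator \<times> bool) list) set"
  where "BS_relations m n =
    {(power_word BS_t (-1) @ power_word BS_a m @ power_word BS_t 1, power_word BS_a n)}"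

definition BS :: "int \<Rightarrow> int \<Rightarrow> (BS_generator \<times> bool) list set monoid"
  where "BS m n = presented_group {BS_a, BS_t} (BS_relations m n)"

definition BS_elem_a :: "int \<Rightarrow> int \<Rightarrow> (BS_generator \<times> bool) list set"
  where "BS_elem_a m n = presented_elem {BS_a, BS_t} (BS_relations m n) (power_word BS_a 1)"

lemma group_BS: "group (BS m n)"
  unfolding BS_def by (rule group_presented_group)

lemma BS_elem_a_closed: "BS_elem_a m n \<in> carrier (BS m n)"
  by (auto simp: BS_elem_a_def BS_def presented_elem_def presented_group_def
      carrier_word_quotient letters_def power_word_def)


section \<open>Free products\<close>

text \<open>Words in the disjoint union of the two carriers, modulo multiplying adjacent letters from the
  same factor and deleting the neutral element of either factor.\<close>

definition free_product_relations ::
    "('a, 'c) monoid_scheme \<Rightarrow> ('b, 'd) monoid_scheme \<Rightarrow> (('a + 'b) list \<times> ('a + 'b) list) set"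
  where "free_product_relations G H =
    {([Inl \<one>\<^bsub>G\<^esub>], []), ([Inr \<one>\<^bsub>H\<^esub>], [])}
    \<union> {([Inl x, Inl y], [Inl (x \<otimes>\<^bsub>G\<^esub> y)]) | x y. x \<in> carrier G \<and> y \<in> carrier G}
    \<union> {([Inr x, Inr y], [Inr (x \<otimes>\<^bsub>H\<^esub> y)]) | x y. x \<in> carrier H \<and> y \<in> carrier H}"

definition free_product ::
    "('a, 'c) monoid_scheme \<Rightarrow> ('b, 'd) monoid_scheme \<Rightarrow> ('a + 'b) list set monoid"
  where "free_product G H = word_quotient (carrier G <+> carrier H) (free_product_relations G H)"

lemma group_free_product:
  assumes "group G" "group H"
  shows "group (free_product G H)"
  unfolding free_product_def
proof (rule group_word_quotient)
  interpret G: group G by fact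
  interpret H: group H by fact
  let ?L = "carrier G <+> carrier H" and ?R = "free_product_relations G H"
  fix l assume "l \<in> ?L"
  then consider (L) x where "l = Inl x" "x \<in> carrier G" | (R) y where "l = Inr y" "y \<in> carrier H"
    by auto
  then show "\<exists>w \<in> lists ?L. (w @ [l], []) \<in> word_cong ?L ?R"
  proof cases
    case L
    have "([Inl (inv\<^bsub>G\<^esub> x), Inl x], [Inl \<one>\<^bsub>G\<^esub>]) \<in> word_cong ?L ?R"
    proof (rule word_cong_base)
      have "([Inl (inv\<^bsub>G\<^esub> x), Inl x], [Inl (inv\<^bsub>G\<^esub> x \<otimes>\<^bsub>G\<^esub> x)]) \<in> ?R"
        unfolding free_product_relations_def using L(2) G.inv_closed[OF L(2)] by blast
      then show "([Inl (inv\<^bsub>G\<^esub> x), Inl x], [Inl \<one>\<^bsub>G\<^esub>]) \<in> ?R"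
        using L(2) by simp
    qed (use L(2) in \<open>simp_all add: InlI InrI\<close>)
    moreover have "([Inl \<one>\<^bsub>G\<^esub>], []) \<in> word_cong ?L ?R"
      by (rule word_cong_base) (simp_all add: free_product_relations_def InlI InrI)
    ultimately have "([Inl (inv\<^bsub>G\<^esub> x), Inl x], []) \<in> word_cong ?L ?R"
      by (rule word_cong.trans)
    then show ?thesis
      using L by (intro bexI[of _ "[Inl (inv\<^bsub>G\<^esub> x)]"]) (simp_all add: InlI InrI)
  next
    case R
    have "([Inr (inv\<^bsub>H\<^esub> y), Inr y], [Inr \<one>\<^bsub>H\<^esub>]) \<in> word_cong ?L ?R"
    proof (rule word_cong_base)
      have "([Inr (inv\<^bsub>H\<^esub> y), Inr y], [Inr (inv\<^bsub>H\<^esub> y \<otimes>\<^bsub>H\<^esub> y)]) \<in> ?R"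
        unfolding free_product_relations_def using R(2) H.inv_closed[OF R(2)] by blast
      then show "([Inr (inv\<^bsub>H\<^esub> y), Inr y], [Inr \<one>\<^bsub>H\<^esub>]) \<in> ?R"
        using R(2) by simp
    qed (use R(2) in \<open>simp_all add: InlI InrI\<close>)
    moreover have "([Inr \<one>\<^bsub>H\<^esub>], []) \<in> word_cong ?L ?R"
      by (rule word_cong_base) (simp_all add: free_product_relations_def InlI InrI)
    ultimately have "([Inr (inv\<^bsub>H\<^esub> y), Inr y], []) \<in> word_cong ?L ?R"
      by (rule word_cong.trans)
    then show ?thesis
      using R by (intro bexI[of _ "[Inr (inv\<^bsub>H\<^esub> y)]"]) (simp_all add: InlI InrI)
  qed
qed


section \<open>Lower central series\<close>

definition commutator :: "('a, 'b) monoid_scheme \<Rightarrow> 'a \<Rightarrow> 'a \<Rightarrow> 'a"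
  where "commutator G x y = inv\<^bsub>G\<^esub> x \<otimes>\<^bsub>G\<^esub> inv\<^bsub>G\<^esub> y \<otimes>\<^bsub>G\<^esub> x \<otimes>\<^bsub>G\<^esub> y"

definition commutator_subgroup :: "('a, 'b) monoid_scheme \<Rightarrow> 'a set \<Rightarrow> 'a set \<Rightarrow> 'a set"
  where "commutator_subgroup G A B = generate G {commutator G x y | x y. x \<in> A \<and> y \<in> B}"

text \<open>The series starts at index 1; the value at index 0 is a dummy.\<close>

fun lower_central :: "('a, 'b) monoid_scheme \<Rightarrow> nat \<Rightarrow> 'a set"
where
  "lower_central G 0 = carrier G"
| "lower_central G (Suc 0) = carrier G"
| "lower_central G (Suc (Suc i)) = commutator_subgroup G (lower_central G (Suc i)) (carrier G)"

lemma subgroup_lower_central: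
  assumes "group G"
  shows "subgroup (lower_central G i) G"
proof -
  interpret group G by fact
  have "subgroup (lower_central G (Suc i)) G" for i
  proof (induction i)
    case 0
    show ?case by (simp add: subgroup_self)
  next
    case (Suc i)
    have "lower_central G (Suc i) \<subseteq> carrier G"
      using Suc by (rule subgroup.subset)
    then show ?case
      by (auto simp: commutator_subgroup_def commutator_def intro!: generate_is_subgroup)
  qed
  then show ?thesis
    by (cases i) (simp_all add: subgroup_self)
qed

definition gamma :: "nat \<Rightarrow> ('a, 'b) monoid_scheme \<Rightarrow> ('a, 'b) monoid_scheme"
  where "gamma i G = G\<lparr>carrier := lower_central G i\<rparr>"

end

theory Submission
  imports Defs
begin

text \<open>For \<open>n = m\<close> and \<open>n = - m\<close> the power \<open>a ^ m\<close> generates a normal subgroup of \<open>BS m n\<close> with quotient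
  \<open>\<int> * \<int>\<^sub>m\<close>, so only the intersection of this subgroup with \<open>gamma i (BS m n)\<close> matters. For \<open>n = m\<close> it is
  trivial, because \<open>a\<close> has infinite order in the abelianisation. For \<open>n = - m\<close> one needs an additive map
  \<open>r\<close> from \<open>gamma i (BS m n)\<close> to the integers with value 1 at \<open>z = a ^ (2 ^ (i - 1) * m)\<close>; then
  \<open>x \<mapsto> (z ^ r x, x mod a ^ m)\<close> is the isomorphism.

  Let \<open>u\<close> be the exponent sum of \<open>a\<close> in which a letter counts with sign \<open>(- 1) ^ k\<close> when \<open>k\<close> is the exponent
  sum of \<open>t\<close> before it. It takes the value \<open>2 ^ (i - 1) * m\<close> at \<open>z\<close>, but on \<open>gamma i\<close> it is only divisible
  by \<open>2 ^ (i - 1)\<close>. It has to be corrected modulo \<open>2 ^ (i - 1) * m\<close> by a functional that vanishes on the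
  powers of \<open>a\<close>: the signed sum \<open>D c\<close>, over the letters \<open>t\<close>, of \<open>j * c k\<close>, where \<open>j\<close> (reduced modulo
  \<open>m\<close>) and \<open>k\<close> are the exponent sums of \<open>a\<close> and \<open>t\<close> before that letter. Taking a commutator with \<open>t\<close>
  multiplies \<open>u\<close> by \<open>- 2\<close> and replaces \<open>c\<close> by a finite difference of \<open>c\<close>, so the right weight on \<open>gamma i\<close>
  is an \<open>(i - 2)\<close>-fold antidifference of \<open>k \<mapsto> (- 1) ^ k\<close>.\<close>

section \<open>Homomorphisms out of presented groups and free products\<close>

definition word_eval :: "('a, 'b) monoid_scheme \<Rightarrow> ('l \<Rightarrow> 'a) \<Rightarrow> 'l list \<Rightarrow> 'a"
  where "word_eval K f w = foldr (\<lambda>l x. f l \<otimes>\<^bsub>K\<^esub> x) w \<one>\<^bsub>K\<^esub>"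

lemma word_eval_simps [simp]:
  "word_eval K f [] = \<one>\<^bsub>K\<^esub>"
  "word_eval K f (l # w) = f l \<otimes>\<^bsub>K\<^esub> word_eval K f w"
  by (simp_all add: word_eval_def)

context group
begin

lemma word_eval_closed:
  assumes "f \<in> L \<rightarrow> carrier G" "w \<in> lists L"
  shows "word_eval G f w \<in> carrier G"
  using assms(2,1) by (induction w) auto

lemma word_eval_append:
  assumes "f \<in> L \<rightarrow> carrier G" "u \<in> lists L" "v \<in> lists L"
  shows "word_eval G f (u @ v) = word_eval G f u \<otimes> word_eval G f v"
  using assms(2,1,3)
proof (induction u)
  case Nil
  then show ?case using word_eval_closed[of f L v] by simp
next
  case (Cons l u)
  have "word_eval G f u \<in> carrier G" "word_eval G f v \<in> carrier G"
    using Cons word_eval_closed[of f L] by auto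
  with Cons show ?case by (auto simp: m_assoc Pi_iff)
qed

lemma word_eval_replicate:
  assumes "f l \<in> carrier G"
  shows "word_eval G f (replicate n l) = f l [^] n"
proof (induction n)
  case (Suc n)
  then show ?case using assms nat_pow_Suc2 by simp
qed simp

lemma word_eval_cong:
  assumes f: "f \<in> L \<rightarrow> carrier G"
    and R: "\<And>u v. (u, v) \<in> R \<Longrightarrow> u \<in> lists L \<Longrightarrow> v \<in> lists L \<Longrightarrow> word_eval G f u = word_eval G f v"
    and "(u, v) \<in> word_cong L R"
  shows "word_eval G f u = word_eval G f v"
  using assms(3)
proof (induction rule: word_cong.induct)
  case (rel u v p q)
  then show ?case
    using R[of u v] f by (simp add: word_eval_append[of f L])
qed auto

text \<open>Evaluation is constant on congruence classes, so it factors through the quotient; this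
  is the common source of the homomorphisms out of presented groups and free products.\<close>

lemma word_quotient_hom:
  assumes f: "f \<in> L \<rightarrow> carrier G"
    and R: "\<And>u v. (u, v) \<in> R \<Longrightarrow> u \<in> lists L \<Longrightarrow> v \<in> lists L \<Longrightarrow> word_eval G f u = word_eval G f v"
  obtains F where "F \<in> hom (word_quotient L R) G"
    and "\<And>w. w \<in> lists L \<Longrightarrow> F (word_class L R w) = word_eval G f w"
proof -
  \<comment> \<open>A class is evaluated at an arbitrary representative;
    \<open>word_eval_cong\<close> makes the choice immaterial.\<close>
  define F where "F U = word_eval G f (SOME w. w \<in> U)" for U
  have F: "F (word_class L R w) = word_eval G f w" if w: "w \<in> lists L" for w
  proof -
    have "w \<in> word_class L R w"
      using w by (simp add: word_class_def word_cong.refl)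
    then have "(SOME w'. w' \<in> word_class L R w) \<in> word_class L R w"
      by (rule someI)
    then have "(w, SOME w'. w' \<in> word_class L R w) \<in> word_cong L R"
      by (simp add: word_class_def)
    from word_eval_cong[OF f R this] show ?thesis
      by (simp add: F_def)
  qed
  moreover have "F \<in> hom (word_quotient L R) G"
  proof (rule homI)
    fix U V assume "U \<in> carrier (word_quotient L R)" "V \<in> carrier (word_quotient L R)"
    then obtain u v where "u \<in> lists L" "U = word_class L R u" "v \<in> lists L" "V = word_class L R v"
      by (auto simp only: carrier_word_quotient)
    then show "F (U \<otimes>\<^bsub>word_quotient L R\<^esub> V) = F U \<otimes> F V"
      by (simp add: mult_word_quotient F word_eval_append[OF f])
  next
    fix U assume "U \<in> carrier (word_quotient L R)"
    then obtain u where "u \<in> lists L" "U = word_class L R u"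
      by (auto simp only: carrier_word_quotient)
    then show "F U \<in> carrier G"
      by (simp add: F word_eval_closed[OF f])
  qed
  ultimately show ?thesis
    using that by blast
qed

end

text \<open>Multiplying the classes of the letters rebuilds the class of the word, so facts on
  \<open>word_eval\<close> carry over to classes.\<close>

lemma word_class_eq_word_eval:
  assumes "w \<in> lists L"
  shows "word_class L R w = word_eval (word_quotient L R) (\<lambda>l. word_class L R [l]) w"
  using assms
proof (induction w)
  case Nil
  show ?case by (simp add: one_word_quotient)
next
  case (Cons l w)
  then show ?case
    using mult_word_quotient[of "[l]" L w R] by simp
qed

lemma hom_eq_on_generate:
  assumes "group_hom G H f" "group_hom G H g" "S \<subseteq> carrier G"
    and "\<And>x. x \<in> S \<Longrightarrow> f x = g x" and "x \<in> generate G S"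
  shows "f x = g x"
proof -
  interpret f: group_hom G H f by fact
  interpret g: group_hom G H g by fact
  show ?thesis
    using assms(5)
  proof (induction rule: generate.induct)
    case (inv h)
    then show ?case using assms(3,4) by (auto simp: subset_iff)
  next
    case (eng h1 h2)
    then show ?case using f.G.generate_in_carrier[OF assms(3)] by simp
  qed (use assms(4) in auto)
qed

lemma carrier_word_quotient_generate:
  assumes "group (word_quotient L R)"
  shows "carrier (word_quotient L R) = generate (word_quotient L R) ((\<lambda>l. word_class L R [l]) ` L)"
    (is "_ = generate ?Q ?S")
proof
  interpret group ?Q by fact
  have S: "?S \<subseteq> carrier ?Q"
    by (auto simp: carrier_word_quotient intro!: imageI)
  then show "generate ?Q ?S \<subseteq> carrier ?Q"
    by (rule generate_incl)
  show "carrier ?Q \<subseteq> generate ?Q ?S"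
  proof
    fix x assume "x \<in> carrier ?Q"
    then obtain w where w: "w \<in> lists L" "x = word_class L R w"
      by (auto simp only: carrier_word_quotient)
    have "word_eval ?Q (\<lambda>l. word_class L R [l]) w \<in> generate ?Q ?S"
      using w(1) by (induction w) (auto intro: generate.one generate.eng generate.incl)
    then show "x \<in> generate ?Q ?S"
      using w word_class_eq_word_eval by metis
  qed
qed

section \<open>Presented groups and the Baumslag-Solitar presentation\<close>

abbreviation BS_elem_t :: "int \<Rightarrow> int \<Rightarrow> (BS_generator \<times> bool) list set"
  where "BS_elem_t m n \<equiv> presented_elem {BS_a, BS_t} (BS_relations m n) (power_word BS_t 1)"

definition signed_letter :: "('a, 'b) monoid_scheme \<Rightarrow> ('x \<Rightarrow> 'a) \<Rightarrow> 'x \<times> bool \<Rightarrow> 'a"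
  where "signed_letter K h = (\<lambda>(x, b). if b then h x else inv\<^bsub>K\<^esub> (h x))"

lemma (in group) word_eval_power_word:
  assumes "h x \<in> carrier G"
  shows "word_eval G (signed_letter G h) (power_word x k) = h x [^] k"
proof -
  have "word_eval G (signed_letter G h) (replicate n (x, b)) = (if b then h x else inv (h x)) [^] n"
    for n b
    by (subst word_eval_replicate) (use assms in \<open>auto simp: signed_letter_def\<close>)
  note * = this
  show ?thesis
  proof (cases "k \<ge> 0")
    case True
    then show ?thesis using *[of "nat k" True] by (simp add: power_word_def)
  next
    case False
    then have "word_eval G (signed_letter G h) (power_word x k) = inv (h x) [^] nat (- k)"
      using *[of "nat (- k)" False] by (simp add: power_word_def)
    also have "\<dots> = inv (h x [^] nat (- k))"
      by (rule nat_pow_inv[OF assms])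
    also have "\<dots> = h x [^] k"
      using False assms by (simp add: int_pow_neg)
    finally show ?thesis .
  qed
qed

lemma power_word_in_lists: "x \<in> X \<Longrightarrow> power_word x k \<in> lists (letters X)"
  by (auto simp: power_word_def letters_def)

text \<open>Von Dyck's theorem: \<open>signed_letter\<close> sends formal inverses to inverses, so
  the cancellation relations hold by themselves and only \<open>R\<close> has to be checked.\<close>

lemma (in group) presented_group_hom:
  assumes h: "h \<in> X \<rightarrow> carrier G"
    and R: "\<And>u v. (u, v) \<in> R \<Longrightarrow> word_eval G (signed_letter G h) u = word_eval G (signed_letter G h) v"
  obtains F where "F \<in> hom (presented_group X R) G"
    and "\<And>w. w \<in> lists (letters X) \<Longrightarrow> F (presented_elem X R w) = word_eval G (signed_letter G h) w"
proof -
  have f: "signed_letter G h \<in> letters X \<rightarrow> carrier G"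
    using h by (auto simp: signed_letter_def letters_def Pi_iff)
  have "word_eval G (signed_letter G h) u = word_eval G (signed_letter G h) v"
    if "(u, v) \<in> cancellation X \<union> R" for u v
    using that R h by (auto simp: cancellation_def signed_letter_def Pi_iff)
  then show thesis
    using word_quotient_hom[OF f, of "cancellation X \<union> R"] that
    by (metis presented_elem_def presented_group_def)
qed

lemma presented_elem_power_word:
  assumes "x \<in> X"
  shows "presented_elem X R (power_word x k) = presented_elem X R (power_word x 1) [^]\<^bsub>presented_group X R\<^esub> k"
proof -
  let ?Q = "presented_group X R" and ?R = "cancellation X \<union> R"
  interpret group ?Q by (rule group_presented_group)
  let ?c = "\<lambda>l. word_class (letters X) ?R [l]"
  have L: "(y, b) \<in> letters X" if "y \<in> X" for y b
    using that by (simp add: letters_def)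
  have c: "?c l \<in> carrier ?Q" if "l \<in> letters X" for l
    using that by (auto simp: presented_group_def carrier_word_quotient)
  \<comment> \<open>Cancellation turns the class of a formal inverse letter into the group inverse,
    so that \<open>?c\<close> acts on letters like a \<open>signed_letter\<close>.\<close>
  have inv: "?c (y, False) = inv\<^bsub>?Q\<^esub> (?c (y, True))" if "y \<in> X" for y
  proof (rule inv_equality[symmetric])
    have "word_class (letters X) ?R [(y, False), (y, True)] = word_class (letters X) ?R []"
    proof (subst word_class_eq_iff)
      show "([(y, False), (y, True)], []) \<in> word_cong (letters X) ?R"
        by (rule word_cong_base) (use that in \<open>auto simp: cancellation_def letters_def\<close>)
    qed (use that in \<open>auto simp: letters_def\<close>)
    then show "?c (y, False) \<otimes>\<^bsub>?Q\<^esub> ?c (y, True) = \<one>\<^bsub>?Q\<^esub>"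
      using that by (simp add: presented_group_def mult_word_quotient one_word_quotient L)
  qed (use c L that in auto)
  have "word_eval ?Q ?c (power_word x k) = word_eval ?Q (signed_letter ?Q (\<lambda>y. ?c (y, True))) (power_word x k)"
    using inv[OF assms] by (simp add: power_word_def word_eval_def foldr_replicate signed_letter_def)
  also have "\<dots> = ?c (x, True) [^]\<^bsub>?Q\<^esub> k"
    using c L assms by (intro word_eval_power_word) auto
  finally show ?thesis
    using word_class_eq_word_eval[OF power_word_in_lists[OF assms], of ?R k]
    by (simp add: presented_elem_def presented_group_def) (simp add: power_word_def)
qed

lemma BS_elem_t_closed: "BS_elem_t m n \<in> carrier (BS m n)"
  by (auto simp: BS_def presented_elem_def presented_group_def
      carrier_word_quotient letters_def power_word_def)

lemma BS_relation:
  "inv\<^bsub>BS m n\<^esub> BS_elem_t m n \<otimes>\<^bsub>BS m n\<^esub> BS_elem_a m n [^]\<^bsub>BS m n\<^esub> m \<otimes>\<^bsub>BS m n\<^esub> BS_elem_t m n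
    = BS_elem_a m n [^]\<^bsub>BS m n\<^esub> n"
proof -
  interpret group "BS m n" by (rule group_BS)
  let ?X = "{BS_a, BS_t}" and ?R = "BS_relations m n"
  note p = presented_elem_power_word[of _ ?X ?R, folded BS_def]
  let ?u = "power_word BS_t (-1)" and ?v = "power_word BS_a m" and ?w = "power_word BS_t 1"
    and ?z = "power_word BS_a n"
  have l: "?u \<in> lists (letters ?X)" "?v \<in> lists (letters ?X)" "?w \<in> lists (letters ?X)"
    "?z \<in> lists (letters ?X)"
    by (rule power_word_in_lists, simp)+
  have "presented_elem ?X ?R (?u @ ?v @ ?w) = presented_elem ?X ?R ?z"
    unfolding presented_elem_def
  proof (subst word_class_eq_iff)
    show "(?u @ ?v @ ?w, ?z) \<in> word_cong (letters ?X) (cancellation ?X \<union> ?R)"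
      by (rule word_cong_base) (use l in \<open>auto simp: BS_relations_def\<close>)
  qed (use l in auto)
  moreover have "presented_elem ?X ?R (?u @ ?v @ ?w)
      = presented_elem ?X ?R ?u \<otimes>\<^bsub>BS m n\<^esub> (presented_elem ?X ?R ?v \<otimes>\<^bsub>BS m n\<^esub> presented_elem ?X ?R ?w)"
    using l by (simp add: presented_elem_def BS_def presented_group_def mult_word_quotient)
  moreover have "presented_elem ?X ?R ?u = inv\<^bsub>BS m n\<^esub> BS_elem_t m n"
    using p[of BS_t "-1"] BS_elem_t_closed[of m n] by (simp add: int_pow_neg)
  ultimately show ?thesis
    using p[of BS_a m] p[of BS_a n] BS_elem_t_closed[of m n] BS_elem_a_closed[of m n]
    by (simp add: BS_elem_a_def m_assoc)
qed

lemma (in group) BS_hom: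
  assumes "x \<in> carrier G" "y \<in> carrier G" "inv y \<otimes> x [^] m \<otimes> y = x [^] (n :: int)"
  obtains F where "F \<in> hom (BS m n) G" "F (BS_elem_a m n) = x" "F (BS_elem_t m n) = y"
proof -
  define h where "h = case_BS_generator x y"
  have h: "h \<in> {BS_a, BS_t} \<rightarrow> carrier G" "h BS_a = x" "h BS_t = y"
    using assms by (auto simp: h_def)
  let ?f = "signed_letter G h"
  have f: "?f \<in> letters {BS_a, BS_t} \<rightarrow> carrier G"
    using h assms by (auto simp: signed_letter_def letters_def)
  have app: "word_eval G ?f (power_word BS_t (-1) @ power_word BS_a m @ power_word BS_t 1)
     = word_eval G ?f (power_word BS_t (-1)) \<otimes>
        (word_eval G ?f (power_word BS_a m) \<otimes> word_eval G ?f (power_word BS_t 1))"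
    by (simp add: word_eval_append[OF f] power_word_in_lists)
  have "word_eval G ?f u = word_eval G ?f v" if "(u, v) \<in> BS_relations m n" for u v
    using that assms h app
    by (auto simp: BS_relations_def word_eval_power_word int_pow_neg m_assoc)
  then obtain F where F: "F \<in> hom (presented_group {BS_a, BS_t} (BS_relations m n)) G"
    "\<And>w. w \<in> lists (letters {BS_a, BS_t}) \<Longrightarrow>
      F (presented_elem {BS_a, BS_t} (BS_relations m n) w) = word_eval G ?f w"
    using presented_group_hom[OF h(1)] by metis
  show thesis
  proof (rule that)
    show "F \<in> hom (BS m n) G"
      using F by (simp add: BS_def)
    show "F (BS_elem_a m n) = x" "F (BS_elem_t m n) = y"
      unfolding BS_elem_a_def using assms h
      by (simp_all add: F(2) power_word_in_lists word_eval_power_word)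
  qed
qed

lemma BS_generate: "carrier (BS m n) = generate (BS m n) {BS_elem_a m n, BS_elem_t m n}"
proof
  interpret group "BS m n" by (rule group_BS)
  let ?X = "{BS_a, BS_t}" and ?R = "cancellation {BS_a, BS_t} \<union> BS_relations m n"
  let ?S = "{BS_elem_a m n, BS_elem_t m n}"
  note p = presented_elem_power_word[of _ ?X "BS_relations m n", folded BS_def]
  have S: "?S \<subseteq> carrier (BS m n)"
    using BS_elem_t_closed BS_elem_a_closed by auto
  then show "generate (BS m n) ?S \<subseteq> carrier (BS m n)"
    by (rule generate_incl)
  have *: "word_class (letters ?X) ?R [l] \<in> generate (BS m n) ?S" if "l \<in> letters ?X" for l
  proof -
    obtain x b where x: "x \<in> ?X" "l = (x, b)"
      using \<open>l \<in> letters ?X\<close> by (auto simp: letters_def)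
    \<comment> \<open>With exponent 1 or -1 the power word is a single letter, so the class of each
      letter is a generator or the inverse of one.\<close>
    have "presented_elem ?X (BS_relations m n) (power_word x (if b then 1 else -1))
        \<in> generate (BS m n) ?S"
      using x(1) S p[of x "-1"] generate.incl[of _ ?S "BS m n"] generate.inv[of _ ?S "BS m n"]
      by (auto simp: BS_elem_a_def int_pow_neg)
    then show ?thesis
      by (cases b) (simp_all add: presented_elem_def power_word_def x)
  qed
  have "carrier (BS m n) = generate (BS m n) ((\<lambda>l. word_class (letters ?X) ?R [l]) ` letters ?X)"
    unfolding BS_def presented_group_def
    by (rule carrier_word_quotient_generate[OF group_BS[unfolded BS_def presented_group_def]])
  also have "\<dots> \<subseteq> generate (BS m n) ?S"
    by (rule generate_subgroup_incl) (use * generate_is_subgroup[OF S] in auto)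
  finally show "carrier (BS m n) \<subseteq> generate (BS m n) ?S" .
qed

section \<open>Free products as coproducts\<close>

abbreviation free_product_elem ::
    "('a, 'c) monoid_scheme \<Rightarrow> ('b, 'd) monoid_scheme \<Rightarrow> 'a + 'b \<Rightarrow> ('a + 'b) list set"
  where "free_product_elem G H l \<equiv>
    word_class (carrier G <+> carrier H) (free_product_relations G H) [l]"

lemma free_product_elem_hom:
  assumes "group G" "group H"
  shows "(\<lambda>x. free_product_elem G H (Inl x)) \<in> hom G (free_product G H)"
    and "(\<lambda>y. free_product_elem G H (Inr y)) \<in> hom H (free_product G H)"
proof -
  interpret G: group G by fact
  interpret H: group H by fact
  let ?L = "carrier G <+> carrier H" and ?R = "free_product_relations G H"
  have eq: "word_class ?L ?R u = word_class ?L ?R v"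
    if "(u, v) \<in> ?R" "u \<in> lists ?L" "v \<in> lists ?L" for u v
    using that by (simp add: word_class_eq_iff word_cong_base)
  show "(\<lambda>x. free_product_elem G H (Inl x)) \<in> hom G (free_product G H)"
  proof (rule homI)
    fix x y assume xy: "x \<in> carrier G" "y \<in> carrier G"
    have "word_class ?L ?R [Inl x, Inl y] = word_class ?L ?R [Inl (x \<otimes>\<^bsub>G\<^esub> y)]"
      by (rule eq) (use xy in \<open>auto simp: free_product_relations_def\<close>)
    then show "free_product_elem G H (Inl (x \<otimes>\<^bsub>G\<^esub> y))
      = free_product_elem G H (Inl x) \<otimes>\<^bsub>free_product G H\<^esub> free_product_elem G H (Inl y)"
      using xy mult_word_quotient[of "[Inl x]" ?L "[Inl y]" ?R]
      by (simp add: free_product_def InlI)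
  qed (auto simp: free_product_def carrier_word_quotient)
  show "(\<lambda>y. free_product_elem G H (Inr y)) \<in> hom H (free_product G H)"
  proof (rule homI)
    fix x y assume xy: "x \<in> carrier H" "y \<in> carrier H"
    have "word_class ?L ?R [Inr x, Inr y] = word_class ?L ?R [Inr (x \<otimes>\<^bsub>H\<^esub> y)]"
      by (rule eq) (use xy in \<open>auto simp: free_product_relations_def\<close>)
    then show "free_product_elem G H (Inr (x \<otimes>\<^bsub>H\<^esub> y))
      = free_product_elem G H (Inr x) \<otimes>\<^bsub>free_product G H\<^esub> free_product_elem G H (Inr y)"
      using xy mult_word_quotient[of "[Inr x]" ?L "[Inr y]" ?R]
      by (simp add: free_product_def InrI)
  qed (auto simp: free_product_def carrier_word_quotient)
qed

text \<open>The relations delete neutral letters and merge adjacent letters of one factor;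
  homomorphisms on the factors respect both.\<close>

lemma free_product_hom:
  assumes "group_hom G K f" "group_hom H K g"
  obtains F where "F \<in> hom (free_product G H) K"
    "\<And>x. x \<in> carrier G \<Longrightarrow> F (free_product_elem G H (Inl x)) = f x"
    "\<And>y. y \<in> carrier H \<Longrightarrow> F (free_product_elem G H (Inr y)) = g y"
proof -
  interpret f: group_hom G K f by fact
  interpret g: group_hom H K g by fact
  let ?L = "carrier G <+> carrier H" and ?R = "free_product_relations G H"
  have L: "case_sum f g \<in> ?L \<rightarrow> carrier K"
    by auto
  have "word_eval K (case_sum f g) u = word_eval K (case_sum f g) v"
    if "(u, v) \<in> ?R" for u v
    using that by (auto simp: free_product_relations_def)
  then obtain F where F: "F \<in> hom (free_product G H) K"
    "\<And>w. w \<in> lists ?L \<Longrightarrow> F (word_class ?L ?R w) = word_eval K (case_sum f g) w"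
    using f.H.word_quotient_hom[OF L, of ?R] unfolding free_product_def by metis
  show thesis
    by (rule that[OF F(1)]) (simp_all add: F(2) InlI InrI)
qed

lemma free_product_generate:
  assumes "group G" "group H"
  shows "carrier (free_product G H) = generate (free_product G H)
    ((\<lambda>x. free_product_elem G H (Inl x)) ` carrier G \<union> (\<lambda>y. free_product_elem G H (Inr y)) ` carrier H)"
proof -
  let ?c = "free_product_elem G H"
  have "?c ` (carrier G <+> carrier H) = (\<lambda>x. ?c (Inl x)) ` carrier G \<union> (\<lambda>y. ?c (Inr y)) ` carrier H"
    by (auto simp: Plus_def image_Un image_image)
  then show ?thesis
    using carrier_word_quotient_generate[OF group_free_product[OF assms, unfolded free_product_def]]
    unfolding free_product_def by simp
qed

section \<open>Lower central series and homomorphisms\<close>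

lemma group_homI: "group G \<Longrightarrow> group H \<Longrightarrow> h \<in> hom G H \<Longrightarrow> group_hom G H h"
  by (simp add: group_hom_def group_hom_axioms_def)

lemma lower_central_subset: "group G \<Longrightarrow> lower_central G i \<subseteq> carrier G"
  by (rule subgroup.subset) (rule subgroup_lower_central)

lemma (in group_hom) hom_commutator:
  "x \<in> carrier G \<Longrightarrow> y \<in> carrier G \<Longrightarrow> h (commutator G x y) = commutator H (h x) (h y)"
  by (simp add: commutator_def)

lemma (in group_hom) commutator_subgroup_image:
  assumes "A \<subseteq> carrier G" "B \<subseteq> carrier G"
  shows "h ` commutator_subgroup G A B = commutator_subgroup H (h ` A) (h ` B)"
proof -
  let ?S = "{commutator G x y | x y. x \<in> A \<and> y \<in> B}"
  have "?S \<subseteq> carrier G"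
    using assms by (auto simp: commutator_def subset_iff)
  then have "h ` generate G ?S = generate H (h ` ?S)"
    by (rule generate_img[symmetric])
  moreover have "h ` ?S = {commutator H x y | x y. x \<in> h ` A \<and> y \<in> h ` B}"
  proof (intro equalityI subsetI)
    fix z assume "z \<in> h ` ?S"
    then obtain x y where "x \<in> A" "y \<in> B" "z = h (commutator G x y)"
      by auto
    then have "z = commutator H (h x) (h y)"
      using assms hom_commutator by blast
    with \<open>x \<in> A\<close> \<open>y \<in> B\<close> show "z \<in> {commutator H x y | x y. x \<in> h ` A \<and> y \<in> h ` B}"
      by blast
  next
    fix z assume "z \<in> {commutator H x y | x y. x \<in> h ` A \<and> y \<in> h ` B}"
    then obtain x y where "x \<in> A" "y \<in> B" "z = commutator H (h x) (h y)"
      by auto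
    moreover from this have "z = h (commutator G x y)"
      using assms by (simp add: hom_commutator subset_iff)
    ultimately show "z \<in> h ` ?S"
      by blast
  qed
  ultimately show ?thesis
    unfolding commutator_subgroup_def by (simp only:)
qed

lemma (in group_hom) lower_central_image_subset: "h ` lower_central G i \<subseteq> lower_central H i"
proof -
  have "h ` lower_central G (Suc i) \<subseteq> lower_central H (Suc i)" for i
  proof (induction i)
    case (Suc i)
    have "{commutator H x y | x y. x \<in> h ` lower_central G (Suc i) \<and> y \<in> h ` carrier G}
        \<subseteq> {commutator H x y | x y. x \<in> lower_central H (Suc i) \<and> y \<in> carrier H}"
      using Suc hom_closed by blast
    then show ?case
      by (simp only: lower_central.simps commutator_subgroup_image[OF lower_central_subset subset_refl]
          G.is_group) (simp add: commutator_subgroup_def H.mono_generate)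
  qed (auto simp: image_subset_iff)
  then show ?thesis
    by (cases i) (auto simp: image_subset_iff)
qed

lemma (in group_hom) lower_central_image:
  assumes "h ` carrier G = carrier H"
  shows "h ` lower_central G i = lower_central H i"
proof -
  have "h ` lower_central G (Suc i) = lower_central H (Suc i)" for i
  proof (induction i)
    case (Suc i)
    then show ?case
      using commutator_subgroup_image[OF lower_central_subset subset_refl] assms G.is_group by simp
  qed (use assms in auto)
  then show ?thesis
    using assms by (cases i) auto
qed

lemma gamma_simps [simp]:
  "carrier (gamma i G) = lower_central G i" "mult (gamma i G) = mult G" "one (gamma i G) = one G"
  by (simp_all add: gamma_def)

lemma lower_central_Suc_subset:
  assumes "group G" "subgroup S G"
    and "\<And>x y. x \<in> lower_central G (Suc i) \<Longrightarrow> y \<in> carrier G \<Longrightarrow> commutator G x y \<in> S"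
  shows "lower_central G (Suc (Suc i)) \<subseteq> S"
proof -
  interpret group G by fact
  show ?thesis
    unfolding lower_central.simps commutator_subgroup_def
    by (rule generate_subgroup_incl) (use assms in auto)
qed

text \<open>The second term lies in the first, and this inclusion propagates because the set of
  generating commutators is monotone in its first argument.\<close>

lemma lower_central_antimono:
  assumes "group G" "0 < i" "i \<le> j"
  shows "lower_central G j \<subseteq> lower_central G i"
proof -
  interpret group G by fact
  have "lower_central G (Suc (Suc n)) \<subseteq> lower_central G (Suc n)" for n
  proof (induction n)
    case 0
    show ?case using lower_central_subset[OF assms(1), of "Suc (Suc 0)"] by simp
  next
    case (Suc n)
    have "{commutator G x y | x y. x \<in> lower_central G (Suc (Suc n)) \<and> y \<in> carrier G}
        \<subseteq> {commutator G x y | x y. x \<in> lower_central G (Suc n) \<and> y \<in> carrier G}"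
      using Suc by blast
    moreover have "\<dots> \<subseteq> carrier G"
      using lower_central_subset[OF assms(1)] by (auto simp: commutator_def subset_iff)
    ultimately show ?case
      unfolding lower_central.simps(3)[of G "Suc n"] lower_central.simps(3)[of G n] commutator_subgroup_def
      by (intro mono_generate)
  qed
  then have "lower_central G (Suc (n + k)) \<subseteq> lower_central G (Suc n)" for n k
    by (induction k) auto
  then show ?thesis
    using assms(2,3) by (metis Suc_pred add_Suc le_add_diff_inverse)
qed

section \<open>Criteria for isomorphisms between lower central terms\<close>

text \<open>A surjection maps each term onto the corresponding term, so it only remains that the
  kernel meets \<open>lower_central G i\<close> trivially.\<close>

lemma (in group_hom) gamma_iso:
  assumes surj: "h ` carrier G = carrier H"
    and ker: "\<And>x. x \<in> lower_central G i \<Longrightarrow> h x = \<one>\<^bsub>H\<^esub> \<Longrightarrow> x = \<one>\<^bsub>G\<^esub>"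
  shows "gamma i G \<cong> gamma i H"
proof -
  interpret S: subgroup "lower_central G i" G
    by (rule subgroup_lower_central) (rule G.is_group)
  have "h \<in> iso (gamma i G) (gamma i H)"
  proof (rule isoI)
    show "h \<in> hom (gamma i G) (gamma i H)"
      using lower_central_image[OF surj, of i] S.mem_carrier by (intro homI) auto
    have "inj_on h (lower_central G i)"
    proof (rule inj_onI)
      fix x y assume xy: "x \<in> lower_central G i" "y \<in> lower_central G i" "h x = h y"
      have "h (x \<otimes>\<^bsub>G\<^esub> inv\<^bsub>G\<^esub> y) = \<one>\<^bsub>H\<^esub>"
        using xy S.mem_carrier by simp
      then have "x \<otimes>\<^bsub>G\<^esub> inv\<^bsub>G\<^esub> y = \<one>\<^bsub>G\<^esub>"
        using xy by (intro ker) auto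
      then show "x = y"
        using xy S.mem_carrier G.inv_equality[of x "inv\<^bsub>G\<^esub> y"] by simp
    qed
    then show "bij_betw h (carrier (gamma i G)) (carrier (gamma i H))"
      using lower_central_image[OF surj] by (simp add: bij_betw_def)
  qed
  then show ?thesis
    by (auto simp: is_iso_def)
qed

lemma (in group) carrier_subgroup_generated_singleton:
  assumes "c \<in> carrier G"
  shows "carrier (subgroup_generated G {c}) = range (\<lambda>k :: int. c [^] k)"
  using assms generate_pow[OF assms] by (auto simp: carrier_subgroup_generated)

text \<open>The map \<open>?f\<close> pairs the power of \<open>c\<close> with exponent
  \<open>r x\<close> with \<open>h x\<close>. The value \<open>r x\<close> controls what
  \<open>h\<close> forgets, and since \<open>c\<close> lies in the kernel of \<open>h\<close>, the
  first coordinate can be adjusted without changing the second.\<close>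

lemma (in group_hom) gamma_iso_DirProd:
  fixes r :: "'a \<Rightarrow> int"
  assumes surj: "h ` carrier G = carrier H"
    and ker: "\<And>x. x \<in> lower_central G i \<Longrightarrow> h x = \<one>\<^bsub>H\<^esub> \<Longrightarrow> r x = 0 \<Longrightarrow> x = \<one>\<^bsub>G\<^esub>"
    and r: "\<And>x y. x \<in> lower_central G i \<Longrightarrow> y \<in> lower_central G i \<Longrightarrow> r (x \<otimes>\<^bsub>G\<^esub> y) = r x + r y"
    and c: "c \<in> lower_central G i" "h c = \<one>\<^bsub>H\<^esub>" "r c = 1"
  shows "gamma i G \<cong> subgroup_generated G {c} \<times>\<times> gamma i H"
proof -
  interpret S: subgroup "lower_central G i" G
    by (rule subgroup_lower_central) (rule G.is_group)
  have cG: "c \<in> carrier G"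
    using c S.mem_carrier by blast
  interpret r: group_hom "gamma i G" integer_group r
    using r S.subgroup_is_group[OF G.is_group]
    by (intro group_homI) (auto simp: gamma_def hom_def)
  have ck: "c [^]\<^bsub>G\<^esub> k \<in> lower_central G i" for k :: int
    using G.subgroup_int_pow_closed[OF S.subgroup_axioms c(1)] .
  \<comment> \<open>In particular \<open>c\<close> has infinite order, so \<open>r x\<close> can be
    read off from the first coordinate.\<close>
  have rck: "r (c [^]\<^bsub>G\<^esub> k) = k" for k :: int
    using r.hom_int_pow[of c k] c(1,3) G.int_pow_consistent[OF S.subgroup_axioms c(1), of k]
    by (simp add: gamma_def)
  have r_inv: "r (inv\<^bsub>G\<^esub> x) = - r x" if "x \<in> lower_central G i" for x
    using r[of x "inv\<^bsub>G\<^esub> x"] r[of "\<one>\<^bsub>G\<^esub>" "\<one>\<^bsub>G\<^esub>"] that S.mem_carrier by simp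
  let ?f = "\<lambda>x. (c [^]\<^bsub>G\<^esub> r x, h x)"
  have "?f \<in> iso (gamma i G) (subgroup_generated G {c} \<times>\<times> gamma i H)"
  proof (rule isoI)
    show "?f \<in> hom (gamma i G) (subgroup_generated G {c} \<times>\<times> gamma i H)"
      using lower_central_image[OF surj, of i] S.mem_carrier cG
      by (intro homI) (auto simp: r G.int_pow_mult G.carrier_subgroup_generated_singleton)
    show "bij_betw ?f (carrier (gamma i G)) (carrier (subgroup_generated G {c} \<times>\<times> gamma i H))"
      unfolding bij_betw_def
    proof (intro conjI inj_onI equalityI subsetI)
      fix x y assume xy: "x \<in> carrier (gamma i G)" "y \<in> carrier (gamma i G)" "?f x = ?f y"
      then have xy': "x \<in> lower_central G i" "y \<in> lower_central G i" "h x = h y" "r x = r y"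
        using rck by (auto dest: arg_cong[of _ _ r])
      have "x \<otimes>\<^bsub>G\<^esub> inv\<^bsub>G\<^esub> y = \<one>\<^bsub>G\<^esub>"
        by (rule ker) (use xy' S.mem_carrier in \<open>simp_all add: r r_inv\<close>)
      then show "x = y"
        using xy' S.mem_carrier G.inv_equality[of x "inv\<^bsub>G\<^esub> y"] by simp
    next
      fix z assume "z \<in> ?f ` carrier (gamma i G)"
      then show "z \<in> carrier (subgroup_generated G {c} \<times>\<times> gamma i H)"
        using lower_central_image[OF surj, of i] cG
        by (auto simp: G.carrier_subgroup_generated_singleton)
    next
      fix z assume "z \<in> carrier (subgroup_generated G {c} \<times>\<times> gamma i H)"
      then obtain k :: int and y where z: "z = (c [^]\<^bsub>G\<^esub> k, y)" "y \<in> lower_central H i"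
        using cG by (auto simp: G.carrier_subgroup_generated_singleton)
      then obtain x where x: "x \<in> lower_central G i" "y = h x"
        using lower_central_image[OF surj, of i] by auto
      \<comment> \<open>A preimage of \<open>y\<close> is corrected by a power of \<open>c\<close>,
        which \<open>h\<close> kills, so that its \<open>r\<close>-value becomes
        \<open>k\<close>.\<close>
      let ?w = "x \<otimes>\<^bsub>G\<^esub> c [^]\<^bsub>G\<^esub> (k - r x)"
      have "?w \<in> lower_central G i" "r ?w = k" "h ?w = y"
        using x ck[of "k - r x"] S.mem_carrier cG c(2) by (simp_all add: r rck hom_int_pow)
      then show "z \<in> ?f ` carrier (gamma i G)"
        using z by (auto intro!: image_eqI[of _ _ ?w])
    qed
  qed
  then show ?thesis
    by (auto simp: is_iso_def)
qed

section \<open>The projection onto the free product\<close>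

text \<open>The generator \<open>a\<close> commutes with \<open>b\<close>, and by the defining
  relation the inverse of \<open>t\<close> conjugates \<open>b\<close> to \<open>b\<close> or to its
  inverse. This passes from the generators to the whole group and will make the subgroup generated
  by \<open>b\<close> normal.\<close>

lemma BS_conjugate_power:
  assumes e: "e = 1 \<or> e = - 1" and n: "n = e * m" and g: "g \<in> carrier (BS m n)"
    and b: "b = BS_elem_a m n [^]\<^bsub>BS m n\<^esub> m"
    and x: "x \<in> {b, inv\<^bsub>BS m n\<^esub> b}"
  shows "g \<otimes>\<^bsub>BS m n\<^esub> x \<otimes>\<^bsub>BS m n\<^esub> inv\<^bsub>BS m n\<^esub> g \<in> {b, inv\<^bsub>BS m n\<^esub> b}"
proof -
  let ?G = "BS m n"
  interpret group ?G by (rule group_BS)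
  let ?a = "BS_elem_a m n" and ?t = "BS_elem_t m n"
  let ?B = "{b, inv\<^bsub>?G\<^esub> b}"
  let ?conj = "\<lambda>g x. g \<otimes>\<^bsub>?G\<^esub> x \<otimes>\<^bsub>?G\<^esub> inv\<^bsub>?G\<^esub> g"
  note at [simp] = BS_elem_a_closed[of m n] BS_elem_t_closed[of m n]
  have bG [simp]: "b \<in> carrier ?G"
    by (simp add: b)
  have cinv: "?conj g (inv\<^bsub>?G\<^esub> b) = inv\<^bsub>?G\<^esub> (?conj g b)" if "g \<in> carrier ?G" for g
    using that by (simp add: inv_mult_group m_assoc)
  have B: "?conj g x \<in> ?B" if "g \<in> carrier ?G" "?conj g b \<in> ?B" "x \<in> ?B" for g x
    using that cinv[of g] by (metis bG insert_iff inv_inv singletonD)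
  \<comment> \<open>Conjugation commutes with inversion, so an element that conjugates
    \<open>b\<close> into \<open>?B\<close> permutes \<open>?B\<close>, and so does its inverse.
    This serves \<open>t\<close> itself, as the relation speaks of its inverse, and the inverses of
    generators.\<close>
  have undo: "?conj (inv\<^bsub>?G\<^esub> g) b \<in> ?B" if g: "g \<in> carrier ?G" "?conj g b \<in> ?B" for g
  proof -
    have "b = ?conj (inv\<^bsub>?G\<^esub> g) (?conj g b)"
      using g(1) by (simp add: m_assoc inv_solve_left)
    moreover have "?conj (inv\<^bsub>?G\<^esub> g) (inv\<^bsub>?G\<^esub> b) = inv\<^bsub>?G\<^esub> (?conj (inv\<^bsub>?G\<^esub> g) b)"
      using cinv[of "inv\<^bsub>?G\<^esub> g"] g(1) by simp
    ultimately show ?thesis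
      using g by (metis bG insert_iff inv_closed inv_inv m_closed singletonD)
  qed
  have a: "?conj ?a b = b"
  proof -
    have "?a \<otimes>\<^bsub>?G\<^esub> b = b \<otimes>\<^bsub>?G\<^esub> ?a"
      using int_pow_mult[of ?a 1 m] int_pow_mult[of ?a m 1] by (simp add: b add.commute)
    then show ?thesis by (simp add: m_assoc)
  qed
  have "?conj (inv\<^bsub>?G\<^esub> ?t) b \<in> ?B"
  proof -
    have "?conj (inv\<^bsub>?G\<^esub> ?t) b = ?a [^]\<^bsub>?G\<^esub> n"
      using BS_relation[of m n] by (simp add: b)
    also have "\<dots> = ?a [^]\<^bsub>?G\<^esub> (m * e)"
      by (simp add: n mult.commute)
    also have "\<dots> = b [^]\<^bsub>?G\<^esub> e"
      unfolding b by (rule int_pow_pow[symmetric]) simp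
    finally show ?thesis
      using e int_pow_1[OF bG] int_pow_neg[OF bG, of 1] by auto
  qed
  then have t: "?conj ?t b \<in> ?B"
    using undo[of "inv\<^bsub>?G\<^esub> ?t"] by simp
  have "g \<in> generate ?G {?a, ?t}"
    using g by (simp only: BS_generate)
  then have "?conj g b \<in> ?B"
  proof (induction rule: generate.induct)
    case (incl h)
    then show ?case using a t by (metis insert_iff singletonD)
  next
    case (inv h)
    then have "h \<in> carrier ?G" "?conj h b \<in> ?B"
      using a t at by (metis insert_iff singletonD)+
    then show ?case by (rule undo)
  next
    case (eng h1 h2)
    have h: "h1 \<in> carrier ?G" "h2 \<in> carrier ?G"
      using eng.hyps by (simp_all only: BS_generate[symmetric])
    have "?conj (h1 \<otimes>\<^bsub>?G\<^esub> h2) b = ?conj h1 (?conj h2 b)"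
      using h by (simp add: inv_mult_group m_assoc)
    then show ?case
      using B[OF h(1) eng.IH(1) eng.IH(2)] by simp
  qed simp
  then show ?thesis
    using B g x by blast
qed

text \<open>\<open>p\<close> sends \<open>a\<close> and \<open>t\<close> to the generators of the
  two factors. For its kernel, a map \<open>q\<close> is built from \<open>Q\<close> to the quotient
  by the normal subgroup \<open>N\<close> generated by \<open>a ^ m\<close>; as \<open>q\<close>
  after \<open>p\<close> is the canonical map, the kernel of \<open>p\<close> lies in
  \<open>N\<close>.\<close>

lemma BS_projection:
  fixes m :: nat
  assumes m: "m > 1" and e: "e = 1 \<or> e = - 1" and n: "n = e * int m"
  defines "Q \<equiv> free_product integer_group (integer_mod_group m)"
  obtains p where "group_hom (BS (int m) n) Q p" "p ` carrier (BS (int m) n) = carrier Q"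
    "p (BS_elem_a (int m) n [^]\<^bsub>BS (int m) n\<^esub> int m) = \<one>\<^bsub>Q\<^esub>"
    "\<And>g. g \<in> carrier (BS (int m) n) \<Longrightarrow> p g = \<one>\<^bsub>Q\<^esub> \<Longrightarrow>
      \<exists>k :: int. g = BS_elem_a (int m) n [^]\<^bsub>BS (int m) n\<^esub> (int m * k)"
proof -
  let ?G = "BS (int m) n"
  let ?a = "BS_elem_a (int m) n" and ?t = "BS_elem_t (int m) n"
  interpret G: group ?G by (rule group_BS)
  interpret Q: group Q
    unfolding Q_def by (rule group_free_product) simp_all
  note at [simp] = BS_elem_a_closed[of "int m" n] BS_elem_t_closed[of "int m" n]
  let ?l = "\<lambda>x. free_product_elem integer_group (integer_mod_group m) (Inl x)"
  let ?r = "\<lambda>y. free_product_elem integer_group (integer_mod_group m) (Inr y)"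
  interpret l: group_hom integer_group Q ?l
    unfolding Q_def using free_product_elem_hom(1)[OF group_integer_group group_integer_mod_group]
    by (simp add: group_hom_def group_hom_axioms_def group_free_product)
  interpret r: group_hom "integer_mod_group m" Q ?r
    unfolding Q_def using free_product_elem_hom(2)[OF group_integer_group group_integer_mod_group]
    by (simp add: group_hom_def group_hom_axioms_def group_free_product)
  have one: "1 \<in> carrier (integer_mod_group m)"
    using m by simp
  have r_pow: "?r 1 [^]\<^bsub>Q\<^esub> k = ?r (k mod int m)" for k :: int
    using r.hom_int_pow[OF one, of k] by (simp add: int_pow_integer_mod_group)
  have l_pow: "?l 1 [^]\<^bsub>Q\<^esub> k = ?l k" for k :: int
    using l.hom_int_pow[of 1 k] by simp
  have r0: "?r 0 = \<one>\<^bsub>Q\<^esub>"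
    using r.hom_one by simp
  have "?r 1 [^]\<^bsub>Q\<^esub> int m = \<one>\<^bsub>Q\<^esub>" "?r 1 [^]\<^bsub>Q\<^esub> n = \<one>\<^bsub>Q\<^esub>"
    using r0 r_pow[of "int m"] r_pow[of n] by (simp_all add: n)
  then obtain p where p: "p \<in> hom ?G Q" "p ?a = ?r 1" "p ?t = ?l 1"
    using Q.BS_hom[of "?r 1" "?l 1" "int m" n] l.hom_closed[of 1] r.hom_closed[OF one] by auto
  interpret p: group_hom ?G Q p
    by unfold_locales (rule p(1))
  have Q_gen: "carrier Q = generate Q (range ?l \<union> ?r ` carrier (integer_mod_group m))"
    unfolding Q_def using free_product_generate[OF group_integer_group group_integer_mod_group] by simp
  have surj: "p ` carrier ?G = carrier Q"
  proof
    show "p ` carrier ?G \<subseteq> carrier Q" by auto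
    have "?l k \<in> p ` carrier ?G" for k
      using p.hom_int_pow[of ?t k] p(3) l_pow[of k] by (metis G.int_pow_closed at(2) image_eqI)
    moreover have "?r k \<in> p ` carrier ?G" if "k \<in> carrier (integer_mod_group m)" for k
    proof -
      have "k mod int m = k"
        using that m by (simp add: carrier_integer_mod_group)
      then show ?thesis
        using p.hom_int_pow[of ?a k] p(2) r_pow[of k] by (metis G.int_pow_closed at(1) image_eqI)
    qed
    ultimately show "carrier Q \<subseteq> p ` carrier ?G"
      unfolding Q_gen using p.img_is_subgroup by (intro Q.generate_subgroup_incl) auto
  qed
  let ?b = "?a [^]\<^bsub>?G\<^esub> int m"
  let ?B = "{?b, inv\<^bsub>?G\<^esub> ?b}"
  define N where "N = generate ?G ?B"
  have conj: "g \<otimes>\<^bsub>?G\<^esub> h \<otimes>\<^bsub>?G\<^esub> inv\<^bsub>?G\<^esub> g \<in> ?B" if "h \<in> ?B" "g \<in> carrier ?G" for h g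
    using BS_conjugate_power[OF e n that(2) HOL.refl that(1)] .
  have "N \<lhd> ?G"
    unfolding N_def by (rule G.normal_generateI[OF _ conj]) auto
  then interpret N: normal N ?G .
  have N_pow: "\<exists>k :: int. g = ?a [^]\<^bsub>?G\<^esub> (int m * k)" if "g \<in> N" for g
    using that unfolding N_def
  proof (induction rule: generate.induct)
    case one
    show ?case by (rule exI[of _ 0]) simp
  next
    case (incl h)
    then have "h = ?a [^]\<^bsub>?G\<^esub> (int m * 1) \<or> h = ?a [^]\<^bsub>?G\<^esub> (int m * -1)"
      by (auto simp: G.int_pow_neg)
    then show ?case by blast
  next
    case (inv h)
    then have "inv\<^bsub>?G\<^esub> h = ?a [^]\<^bsub>?G\<^esub> (int m * 1) \<or> inv\<^bsub>?G\<^esub> h = ?a [^]\<^bsub>?G\<^esub> (int m * -1)"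
      by (auto simp: G.int_pow_neg)
    then show ?case by blast
  next
    case (eng h1 h2)
    then obtain k1 k2 :: int where "h1 = ?a [^]\<^bsub>?G\<^esub> (int m * k1)" "h2 = ?a [^]\<^bsub>?G\<^esub> (int m * k2)"
      by blast
    then have "h1 \<otimes>\<^bsub>?G\<^esub> h2 = ?a [^]\<^bsub>?G\<^esub> (int m * (k1 + k2))"
      by (simp add: G.int_pow_mult distrib_left)
    then show ?case by blast
  qed
  let ?M = "?G Mod N"
  interpret M: group ?M by (rule N.factorgroup_is_group)
  interpret c: group_hom ?G ?M "\<lambda>g. N #>\<^bsub>?G\<^esub> g"
    by unfold_locales (rule N.r_coset_hom_Mod)
  let ?c = "\<lambda>g. N #>\<^bsub>?G\<^esub> g"
  have b_one: "?c ?b = \<one>\<^bsub>?M\<^esub>"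
  proof -
    have "?b \<in> N"
      unfolding N_def by (rule generate.incl) simp
    then show ?thesis
      using G.coset_join2[of ?b N] N.subgroup_axioms by simp
  qed
  \<comment> \<open>The coset of a power of \<open>a\<close> depends on the exponent modulo
    \<open>m\<close> only, so these cosets define a homomorphism on
    \<open>integer_mod_group m\<close>, whose addition reduces modulo \<open>m\<close>.\<close>
  have a_mod: "?c (?a [^]\<^bsub>?G\<^esub> (k mod int m)) = ?c (?a [^]\<^bsub>?G\<^esub> k)" for k :: int
  proof -
    have "?a [^]\<^bsub>?G\<^esub> k = ?a [^]\<^bsub>?G\<^esub> (k mod int m) \<otimes>\<^bsub>?G\<^esub> ?b [^]\<^bsub>?G\<^esub> (k div int m)"
      by (simp add: G.int_pow_pow flip: G.int_pow_mult)
    then show ?thesis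
      by (simp only: c.hom_mult c.hom_int_pow G.int_pow_closed at b_one)
        (simp add: c.hom_int_pow[symmetric] del: mult_FactGroup one_FactGroup)
  qed
  have t_hom: "group_hom integer_group ?M (\<lambda>k. ?c (?t [^]\<^bsub>?G\<^esub> k))"
    by (rule group_homI) (auto intro!: homI simp: G.int_pow_mult simp del: mult_FactGroup one_FactGroup)
  have a_hom: "group_hom (integer_mod_group m) ?M (\<lambda>k. ?c (?a [^]\<^bsub>?G\<^esub> k))"
    by (rule group_homI) (auto intro!: homI simp: G.int_pow_mult a_mod simp del: mult_FactGroup one_FactGroup)
  obtain q where q: "q \<in> hom Q ?M"
    "\<And>k. k \<in> carrier integer_group \<Longrightarrow> q (?l k) = ?c (?t [^]\<^bsub>?G\<^esub> k)"
    "\<And>k. k \<in> carrier (integer_mod_group m) \<Longrightarrow> q (?r k) = ?c (?a [^]\<^bsub>?G\<^esub> k)"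
    unfolding Q_def by (rule free_product_hom[OF t_hom a_hom]) blast
  interpret q: group_hom Q ?M q
    by unfold_locales (rule q(1))
  have qp: "q (p g) = ?c g" if "g \<in> carrier ?G" for g
  proof -
    have "(q \<circ> p) g = ?c g"
    proof (rule hom_eq_on_generate[of ?G ?M "q \<circ> p" ?c "{?a, ?t}" g])
      show "group_hom ?G ?M (q \<circ> p)"
        using hom_compose[OF p(1) q(1)] by unfold_locales
      show "g \<in> generate ?G {?a, ?t}"
        using that by (simp only: BS_generate)
    qed (use p q(2)[of 1] q(3)[OF one] c.group_hom_axioms in auto)
    then show ?thesis by simp
  qed
  show thesis
  proof (rule that)
    show "group_hom ?G Q p" by unfold_locales
    show "p ?b = \<one>\<^bsub>Q\<^esub>"
      using p.hom_int_pow[of ?a "int m"] r_pow[of "int m"] r0 p(2) by simp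
    fix g assume g: "g \<in> carrier ?G" "p g = \<one>\<^bsub>Q\<^esub>"
    then have "N #>\<^bsub>?G\<^esub> g = N"
      using qp[OF g(1)] q.hom_one by (simp only: one_FactGroup)
    then have "g \<in> N"
      by (rule G.coset_join1[OF _ g(1) N.subgroup_axioms])
    then show "\<exists>k :: int. g = ?a [^]\<^bsub>?G\<^esub> (int m * k)"
      by (rule N_pow)
  qed (rule surj)
qed

section \<open>Forward differences\<close>

definition alt :: "int \<Rightarrow> int"
  where "alt k = (if even k then 1 else - 1)"

lemma alt_simps [simp]: "alt 0 = 1" "alt 1 = - 1" "alt (- k) = alt k" "alt k * alt k = 1"
  by (simp_all add: alt_def)

lemma alt_add: "alt (k + l) = alt k * alt l" and alt_diff: "alt (k - l) = alt k * alt l"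
  by (auto simp: alt_def)

definition fdiff :: "(int \<Rightarrow> int) \<Rightarrow> int \<Rightarrow> int"
  where "fdiff b k = b (k + 1) - b k"

lemma fdiff_pow_add: "(fdiff ^^ n) (\<lambda>k. b k + c k) = (\<lambda>k. (fdiff ^^ n) b k + (fdiff ^^ n) c k)"
  by (induction n) (auto simp: fdiff_def fun_eq_iff)

lemma fdiff_pow_diff: "(fdiff ^^ n) (\<lambda>k. b k - c k) = (\<lambda>k. (fdiff ^^ n) b k - (fdiff ^^ n) c k)"
  by (induction n) (auto simp: fdiff_def fun_eq_iff)

lemma fdiff_pow_shift: "(fdiff ^^ n) (\<lambda>k. b (k - s)) = (\<lambda>k. (fdiff ^^ n) b (k - s))"
  by (induction n) (auto simp: fdiff_def fun_eq_iff algebra_simps)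

text \<open>Antidifferences provide the weights on the lower central terms, and they allow any
  weight to be written as a difference.\<close>

lemma fdiff_surj: "\<exists>b. fdiff b = c"
proof
  \<comment> \<open>The sum starts at 0; for negative \<open>k\<close> it is minus the sum of
    \<open>c\<close> over \<open>k\<close>, ..., -1.\<close>
  let ?b = "\<lambda>k. if k \<ge> 0 then \<Sum>i<nat k. c (int i) else - (\<Sum>i<nat (- k). c (- 1 - int i))"
  have "?b (k + 1) - ?b k = c k" for k
  proof (cases "k \<ge> 0")
    case True
    then have "nat (k + 1) = Suc (nat k)" by simp
    with True show ?thesis by simp
  next
    case False
    then have "nat (- k) = Suc (nat (- (k + 1)))" by simp
    with False show ?thesis by (cases "k = - 1") simp_all
  qed
  then show "fdiff ?b = c"
    by (simp add: fdiff_def fun_eq_iff)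
qed

lemma fdiff_pow_surj: "\<exists>b. (fdiff ^^ n) b = c"
  by (induction n) (simp, metis fdiff_surj comp_apply funpow.simps(2) funpow_swap1)

text \<open>The difference of \<open>alt\<close> is \<open>- 2 * alt\<close>, so
  \<open>2 * e + alt\<close> is constant and the change of \<open>e\<close> under the shift is half
  of \<open>alt k - alt (k - s)\<close>.\<close>

lemma fdiff_eq_alt:
  assumes "fdiff e = alt"
  shows "e (k - s) - e k = (if even s then 0 else alt k)"
proof -
  have step: "e (k + 1) = e k + alt k" for k
    using fun_cong[OF assms, of k] by (simp add: fdiff_def)
  have "2 * e k = 2 * e 0 + 1 - alt k" for k
  proof (induction k rule: int_induct[of _ 0])
    case (step1 i)
    then show ?case using step[of i] by (simp add: alt_add)
  next
    case (step2 i)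
    then show ?case using step[of "i - 1"] by (simp add: alt_diff)
  qed simp
  from this[of "k - s"] this[of k] show ?thesis
    by (auto simp: alt_diff) (auto simp: alt_def)
qed

section \<open>A group detecting the powers of the generator\<close>

text \<open>A quadruple \<open>(D, A, s, u)\<close> records, for a word \<open>w\<close>: the exponent sums \<open>A\<close> of \<open>a\<close>, modulo \<open>2 m\<close>, and \<open>s\<close>
  of \<open>t\<close>; the sign-weighted exponent sum \<open>u\<close> of \<open>a\<close>; and \<open>D c j\<close>, the sum \<open>D c\<close> from the introduction for
  a path that starts at \<open>a\<close>-position \<open>j\<close>. The last condition is summation by parts along the path for the
  function \<open>(- 1) ^ k * j\<close>.\<close>

type_synonym twist = "((int \<Rightarrow> int) \<Rightarrow> int \<Rightarrow> int) \<times> int \<times> int \<times> int"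

text \<open>Moving the start by one \<open>a\<close>-step adds the signed sum of the weights over
  the letters \<open>t\<close>, which telescopes to \<open>b s - b 0\<close> for the weight
  \<open>fdiff b\<close>; as positions are reduced, this holds modulo \<open>m\<close>.
  \<open>A\<close> is kept modulo \<open>2 * m\<close> because the last congruence, in which
  \<open>D\<close> is doubled, has that modulus.\<close>

definition twist_carrier :: "int \<Rightarrow> twist set"
  where "twist_carrier m = {(D, A, s, u).
     A \<in> {0..<2 * m}
     \<and> (\<forall>c j j'. m dvd j - j' \<longrightarrow> D c j = D c j')
     \<and> (\<forall>b c j. D (\<lambda>k. b k + c k) j = D b j + D c j)
     \<and> (\<forall>b j. m dvd D (fdiff b) (j + 1) - D (fdiff b) j - (b s - b 0))
     \<and> (\<forall>j. 2 * m dvd u - 2 * D alt j - alt s * (j + A) + j)}"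

text \<open>Concatenation of paths: the second one starts at \<open>a\<close>-position
  \<open>j + A\<close> and \<open>t\<close>-position \<open>s\<close>, which shifts its weights and
  multiplies its signed sum \<open>u'\<close> by \<open>alt s\<close>.\<close>

definition twist_mult :: "int \<Rightarrow> twist \<Rightarrow> twist \<Rightarrow> twist"
  where "twist_mult m = (\<lambda>(D, A, s, u) (D', A', s', u').
    (\<lambda>c j. D c j + D' (\<lambda>k. c (k + s)) (j + A), (A + A') mod (2 * m), s + s', u + alt s * u'))"

definition twist_inv :: "int \<Rightarrow> twist \<Rightarrow> twist"
  where "twist_inv m = (\<lambda>(D, A, s, u).
    (\<lambda>c j. - D (\<lambda>k. c (k - s)) (j - A), - A mod (2 * m), - s, - alt s * u))"

definition twist_group :: "int \<Rightarrow> twist monoid"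
  where "twist_group m =
    \<lparr>carrier = twist_carrier m, monoid.mult = twist_mult m, one = (\<lambda>c j. 0, 0, 0, 0)\<rparr>"

lemma twist_group_simps [simp]:
  "carrier (twist_group m) = twist_carrier m" "mult (twist_group m) = twist_mult m"
  "one (twist_group m) = (\<lambda>c j. 0, 0, 0, 0)"
  by (simp_all add: twist_group_def)

lemma twist_carrierD:
  assumes "(D, A, s, u) \<in> twist_carrier m"
  shows "A \<in> {0..<2 * m}"
    and "m dvd j - j' \<Longrightarrow> D c j = D c j'"
    and "D (\<lambda>k. b k + c k) j = D b j + D c j"
    and "m dvd D (fdiff b) (j + 1) - D (fdiff b) j - (b s - b 0)"
    and "2 * m dvd u - 2 * D alt j - alt s * (j + A) + j"
  using assms unfolding twist_carrier_def by blast+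

lemma twist_carrier_uminus:
  assumes "(D, A, s, u) \<in> twist_carrier m"
  shows "D (\<lambda>k. - c k) j = - D c j"
  using twist_carrierD(3)[OF assms, of c "\<lambda>k. - c k" j]
    twist_carrierD(3)[OF assms, of "\<lambda>k. 0" "\<lambda>k. 0" j] by simp

lemma twist_carrier_alt_mult:
  assumes "(D, A, s, u) \<in> twist_carrier m"
  shows "D (\<lambda>k. alt r * c k) j = alt r * D c j"
  using twist_carrier_uminus[OF assms] by (simp add: alt_def)

lemma twist_mult_closed:
  assumes m: "m > 0" and x: "x \<in> twist_carrier m" and y: "y \<in> twist_carrier m"
  shows "twist_mult m x y \<in> twist_carrier m"
proof -
  obtain D A s u where x': "x = (D, A, s, u)" by (cases x)
  obtain E B r v where y': "y = (E, B, r, v)" by (cases y)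
  note X = x[unfolded x'] and Y = y[unfolded y']
  let ?D = "\<lambda>c j. D c j + E (\<lambda>k. c (k + s)) (j + A)"
  have "?D c j = ?D c j'" if "m dvd j - j'" for c j j'
    using twist_carrierD(2)[OF X that, of c] twist_carrierD(2)[OF Y, of "j + A" "j' + A"] that by simp
  moreover have "?D (\<lambda>k. b k + c k) j = ?D b j + ?D c j" for b c j
    using twist_carrierD(3)[OF X, of b c j]
      twist_carrierD(3)[OF Y, of "\<lambda>k. b (k + s)" "\<lambda>k. c (k + s)" "j + A"] by simp
  moreover have "m dvd ?D (fdiff b) (j + 1) - ?D (fdiff b) j - (b (s + r) - b 0)" for b j
  proof -
    have "fdiff (\<lambda>k. b (k + s)) = (\<lambda>k. fdiff b (k + s))"
      by (simp add: fdiff_def fun_eq_iff algebra_simps)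
    \<comment> \<open>The second path telescopes from level \<open>s\<close> to level
      \<open>s + r\<close>; the first one accounts for the levels from 0 to
      \<open>s\<close>.\<close>
    then have "m dvd E (\<lambda>k. fdiff b (k + s)) (j + 1 + A) - E (\<lambda>k. fdiff b (k + s)) (j + A)
        - (b (s + r) - b s)"
      using twist_carrierD(4)[OF Y, of "\<lambda>k. b (k + s)" "j + A"] by (simp add: add.commute add.left_commute)
    from dvd_add[OF twist_carrierD(4)[OF X, of b j] this] show ?thesis
      by (simp add: algebra_simps)
  qed
  moreover have "2 * m dvd (u + alt s * v) - 2 * ?D alt j - alt (s + r) * (j + (A + B) mod (2 * m)) + j" for j
  proof -
    obtain q where q: "A + B = (A + B) mod (2 * m) + 2 * m * q"
      by (metis mod_mult_div_eq)
    have "E (\<lambda>k. alt (k + s)) (j + A) = alt s * E alt (j + A)"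
      using twist_carrier_alt_mult[OF Y, of s alt] by (simp add: alt_add mult.commute)
    \<comment> \<open>The congruence for \<open>x\<close> at \<open>j\<close>, plus
      \<open>alt s\<close> times the one for \<open>y\<close> at \<open>j + A\<close>, plus a
      multiple of \<open>2 * m\<close> from reducing \<open>A + B\<close>.\<close>
    then have "(u + alt s * v) - 2 * ?D alt j - alt (s + r) * (j + (A + B) mod (2 * m)) + j
      = (u - 2 * D alt j - alt s * (j + A) + j)
        + (alt s * (v - 2 * E alt (j + A) - alt r * (j + A + B) + (j + A)) + 2 * m * (alt s * alt r * q))"
      using arg_cong[OF q, of "\<lambda>z. alt s * (alt r * z)"]
      by (simp add: alt_add algebra_simps)
    then show ?thesis
      using twist_carrierD(5)[OF X, of j] twist_carrierD(5)[OF Y, of "j + A"]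
      by (metis dvd_add dvd_mult dvd_triv_left)
  qed
  ultimately show ?thesis
    using m unfolding x' y' twist_mult_def twist_carrier_def by simp
qed

lemma twist_inv_closed:
  assumes m: "m > 0" and x: "x \<in> twist_carrier m"
  shows "twist_inv m x \<in> twist_carrier m"
proof -
  obtain D A s u where x': "x = (D, A, s, u)" by (cases x)
  note X = x[unfolded x']
  let ?D = "\<lambda>c j. - D (\<lambda>k. c (k - s)) (j - A)"
  have "?D c j = ?D c j'" if "m dvd j - j'" for c j j'
    using twist_carrierD(2)[OF X, of "j - A" "j' - A"] that by simp
  moreover have "?D (\<lambda>k. b k + c k) j = ?D b j + ?D c j" for b c j
    using twist_carrierD(3)[OF X, of "\<lambda>k. b (k - s)" "\<lambda>k. c (k - s)" "j - A"] by simp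
  moreover have "m dvd ?D (fdiff b) (j + 1) - ?D (fdiff b) j - (b (- s) - b 0)" for b j
  proof -
    have "fdiff (\<lambda>k. b (k - s)) = (\<lambda>k. fdiff b (k - s))"
      by (simp add: fdiff_def fun_eq_iff algebra_simps)
    then have "m dvd D (\<lambda>k. fdiff b (k - s)) (j + 1 - A) - D (\<lambda>k. fdiff b (k - s)) (j - A)
        - (b 0 - b (- s))"
      using twist_carrierD(4)[OF X, of "\<lambda>k. b (k - s)" "j - A"] by (simp add: diff_add_eq)
    then have "m dvd - (D (\<lambda>k. fdiff b (k - s)) (j + 1 - A) - D (\<lambda>k. fdiff b (k - s)) (j - A)
        - (b 0 - b (- s)))"
      by (simp only: dvd_minus_iff)
    then show ?thesis
      by (simp add: algebra_simps)
  qed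
  moreover have "2 * m dvd - alt s * u - 2 * ?D alt j - alt (- s) * (j + (- A) mod (2 * m)) + j" for j
  proof -
    obtain q where q: "- A = (- A) mod (2 * m) + 2 * m * q"
      by (metis mod_mult_div_eq)
    have "D (\<lambda>k. alt (k - s)) (j - A) = alt s * D alt (j - A)"
      using twist_carrier_alt_mult[OF X, of s alt] by (simp add: alt_diff mult.commute)
    moreover have "alt s * (alt s * j) = j"
      by (simp add: mult.assoc[symmetric])
    \<comment> \<open>The congruence for \<open>x\<close> at \<open>j - A\<close>, where a path
      \<open>x\<close> ending at \<open>j\<close> starts, is multiplied by \<open>- alt s\<close>;
      the last term comes from reducing \<open>- A\<close>.\<close>
    ultimately have "- alt s * u - 2 * ?D alt j - alt (- s) * (j + (- A) mod (2 * m)) + j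
      = - alt s * (u - 2 * D alt (j - A) - alt s * (j - A + A) + (j - A)) + 2 * m * (alt s * q)"
      using arg_cong[OF q, of "\<lambda>z. alt s * z"] by (simp add: algebra_simps)
    then show ?thesis
      using twist_carrierD(5)[OF X, of "j - A"]
      by (metis dvd_add dvd_mult dvd_triv_left)
  qed
  ultimately show ?thesis
    using m unfolding x' twist_inv_def twist_carrier_def by simp
qed

lemma twist_inv_mult:
  assumes m: "m > 0" and x: "x \<in> twist_carrier m"
  shows "twist_mult m (twist_inv m x) x = (\<lambda>c j. 0, 0, 0, 0)"
proof -
  obtain D A s u where x': "x = (D, A, s, u)" by (cases x)
  note X = x[unfolded x']
  have "D c (j - A) = D c (j + (- A) mod (2 * m))" for c j
  proof (rule twist_carrierD(2)[OF X])
    have "m dvd - A - (- A) mod (2 * m)"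
      using dvd_minus_mod[of "2 * m" "- A"] by (rule dvd_mult_right)
    then show "m dvd j - A - (j + (- A) mod (2 * m))"
      by simp
  qed
  moreover have "((- A) mod (2 * m) + A) mod (2 * m) = 0"
    by (simp add: mod_add_left_eq)
  ultimately show ?thesis
    unfolding x' twist_mult_def twist_inv_def by (simp add: fun_eq_iff)
qed

lemma group_twist_group:
  assumes m: "m > 0"
  shows "group (twist_group m)"
proof (rule groupI)
  fix x y z
  assume xyz: "x \<in> carrier (twist_group m)" "y \<in> carrier (twist_group m)" "z \<in> carrier (twist_group m)"
  obtain D A s u where x: "x = (D, A, s, u)" by (cases x)
  obtain E B r v where y: "y = (E, B, r, v)" by (cases y)
  obtain F C q w where z: "z = (F, C, q, w)" by (cases z)
  have Z: "(F, C, q, w) \<in> twist_carrier m"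
    using xyz z by simp
  \<comment> \<open>The reduction of \<open>A + B\<close> affects the start of the third path, which
    \<open>F\<close> sees only modulo \<open>m\<close>.\<close>
  have "F c (j + (A + B) mod (2 * m)) = F c (j + A + B)" for c j
  proof (rule twist_carrierD(2)[OF Z])
    have "m dvd (A + B) - (A + B) mod (2 * m)"
      using dvd_minus_mod[of "2 * m" "A + B"] by (rule dvd_mult_right)
    then have "m dvd (A + B) mod (2 * m) - (A + B)"
      by (simp only: dvd_diff_commute)
    then show "m dvd j + (A + B) mod (2 * m) - (j + A + B)"
      by (simp add: algebra_simps)
  qed
  then show "x \<otimes>\<^bsub>twist_group m\<^esub> y \<otimes>\<^bsub>twist_group m\<^esub> z = x \<otimes>\<^bsub>twist_group m\<^esub> (y \<otimes>\<^bsub>twist_group m\<^esub> z)"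
    unfolding x y z
    by (auto simp: twist_mult_def fun_eq_iff alt_add algebra_simps mod_simps)
next
  fix x assume x: "x \<in> carrier (twist_group m)"
  show "\<one>\<^bsub>twist_group m\<^esub> \<otimes>\<^bsub>twist_group m\<^esub> x = x"
    using x by (auto simp: twist_mult_def twist_carrier_def)
  show "\<exists>y \<in> carrier (twist_group m). y \<otimes>\<^bsub>twist_group m\<^esub> x = \<one>\<^bsub>twist_group m\<^esub>"
    using x twist_inv_mult[OF m] twist_inv_closed[OF m] by (intro bexI[of _ "twist_inv m x"]) simp_all
qed (use m twist_mult_closed in \<open>auto simp: twist_carrier_def\<close>)

lemma inv_twist_group:
  assumes "m > 0" "x \<in> twist_carrier m"
  shows "inv\<^bsub>twist_group m\<^esub> x = twist_inv m x"
  by (rule group.inv_equality[OF group_twist_group])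
    (use assms twist_inv_mult twist_inv_closed in auto)

section \<open>Lower central series of the Baumslag-Solitar groups\<close>

definition twist_layer :: "int \<Rightarrow> nat \<Rightarrow> twist set"
  where "twist_layer m n = {(D, A, s, u) \<in> twist_carrier m. A = 0 \<and> s = 0
    \<and> (\<forall>c j. (fdiff ^^ n) c = alt \<longrightarrow> 2 ^ (n + 1) * m dvd u - 2 * (- 2) ^ n * D c j)}"

lemma twist_layer_carrier: "x \<in> twist_layer m n \<Longrightarrow> x \<in> twist_carrier m"
  by (auto simp: twist_layer_def)

text \<open>For \<open>A = 0\<close> and \<open>s = 0\<close> the product adds \<open>D\<close> and
  \<open>u\<close>, and the divisibility is linear in both.\<close>

lemma subgroup_twist_layer:
  assumes m: "m > 0"
  shows "subgroup (twist_layer m n) (twist_group m)"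
proof -
  interpret group "twist_group m" by (rule group_twist_group[OF m])
  show ?thesis
  proof (rule subgroupI)
    show "twist_layer m n \<subseteq> carrier (twist_group m)"
      by (auto simp: twist_layer_def)
    have "(\<lambda>c j. 0, 0, 0, 0) \<in> twist_layer m n"
      using m by (auto simp: twist_layer_def twist_carrier_def)
    then show "twist_layer m n \<noteq> {}" by blast
  next
    fix x assume x: "x \<in> twist_layer m n"
    then obtain D u where x': "x = (D, 0, 0, u)"
      by (auto simp: twist_layer_def)
    have "2 ^ (n + 1) * m dvd - u - 2 * (- 2) ^ n * - D c j" if "(fdiff ^^ n) c = alt" for c j
    proof -
      have "2 ^ (n + 1) * m dvd - (u - 2 * (- 2) ^ n * D c j)"
        using x that unfolding x' twist_layer_def dvd_minus_iff by blast
      then show ?thesis by simp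
    qed
    moreover have "twist_inv m x \<in> twist_carrier m"
      by (rule twist_inv_closed[OF m twist_layer_carrier[OF x]])
    ultimately show "inv\<^bsub>twist_group m\<^esub> x \<in> twist_layer m n"
      unfolding inv_twist_group[OF m twist_layer_carrier[OF x]]
      by (simp add: twist_layer_def x' twist_inv_def)
  next
    fix x y assume x: "x \<in> twist_layer m n" and y: "y \<in> twist_layer m n"
    then obtain D u E v where x': "x = (D, 0, 0, u)" and y': "y = (E, 0, 0, v)"
      by (auto simp: twist_layer_def)
    have "2 ^ (n + 1) * m dvd (u + v) - 2 * (- 2) ^ n * (D c j + E c j)"
      if "(fdiff ^^ n) c = alt" for c j
    proof -
      have "2 ^ (n + 1) * m dvd (u - 2 * (- 2) ^ n * D c j) + (v - 2 * (- 2) ^ n * E c j)"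
        using x y that unfolding x' y' twist_layer_def by (intro dvd_add) blast+
      then show ?thesis by (simp add: algebra_simps)
    qed
    moreover have "twist_mult m x y \<in> twist_carrier m"
      by (rule twist_mult_closed[OF m twist_layer_carrier[OF x] twist_layer_carrier[OF y]])
    ultimately show "x \<otimes>\<^bsub>twist_group m\<^esub> y \<in> twist_layer m n"
      by (simp add: twist_layer_def x' y' twist_mult_def)
  qed
qed

text \<open>\<open>A\<close> and \<open>s\<close> are homomorphisms to abelian groups and vanish on
  commutators; summation by parts then reduces to the divisibility for \<open>n = 0\<close>, where
  the only weight is \<open>alt\<close>.\<close>

lemma commutator_twist_layer_0:
  assumes m: "m > 0" and x: "x \<in> twist_carrier m" and y: "y \<in> twist_carrier m"
  shows "commutator (twist_group m) x y \<in> twist_layer m 0"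
proof -
  interpret group "twist_group m" by (rule group_twist_group[OF m])
  let ?z = "commutator (twist_group m) x y"
  obtain D A s u where z: "?z = (D, A, s, u)" by (cases ?z)
  have Z: "(D, A, s, u) \<in> twist_carrier m"
    using m_closed inv_closed x y unfolding z[symmetric] commutator_def by (metis twist_group_simps(1))
  obtain D1 A1 s1 u1 where x': "x = (D1, A1, s1, u1)" by (cases x)
  obtain D2 A2 s2 u2 where y': "y = (D2, A2, s2, u2)" by (cases y)
  have "A = 0" "s = 0"
    using z inv_twist_group[OF m x] inv_twist_group[OF m y]
    by (auto simp: commutator_def x' y' twist_inv_def twist_mult_def mod_simps)
  moreover from this have "2 * m dvd u - 2 * D alt j" for j
    using twist_carrierD(5)[OF Z, of j] by simp
  ultimately show ?thesis
    using Z by (simp add: twist_layer_def z)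
qed

text \<open>The commutator depends on \<open>y\<close> only through \<open>s\<close> and
  \<open>B\<close>, and on \<open>B\<close> only up to multiples of \<open>m\<close> in the
  \<open>D\<close>-component. For odd \<open>s\<close> the shift difference \<open>d\<close> of
  \<open>c\<close> is an admissible weight for \<open>x\<close>, and the corrected sum of
  \<open>x\<close> is multiplied by \<open>- 2\<close>. For even \<open>s\<close> the factor of
  \<open>u\<close> is 0, and the term in \<open>D d\<close> must be divisible by itself.\<close>

lemma commutator_twist_layer_Suc:
  assumes m: "m > 0" and x: "x \<in> twist_layer m n" and y: "y \<in> twist_carrier m"
  shows "commutator (twist_group m) x y \<in> twist_layer m (Suc n)"
proof -
  interpret group "twist_group m" by (rule group_twist_group[OF m])
  obtain D u where x': "x = (D, 0, 0, u)"
    using x by (auto simp: twist_layer_def)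
  have X: "(D, 0, 0, u) \<in> twist_carrier m"
    using twist_layer_carrier[OF x] by (simp add: x')
  have layer: "2 ^ (n + 1) * m dvd u - 2 * (- 2) ^ n * D c j" if "(fdiff ^^ n) c = alt" for c j
    using x that unfolding x' twist_layer_def by blast
  obtain E B s v where y': "y = (E, B, s, v)" by (cases y)
  have Y: "(E, B, s, v) \<in> twist_carrier m"
    using y by (simp add: y')
  have B: "m dvd j - B - (j + (- B) mod (2 * m))" for j
  proof -
    have "m dvd - B - (- B) mod (2 * m)"
      using dvd_minus_mod[of "2 * m" "- B"] by (rule dvd_mult_right)
    then show ?thesis by simp
  qed
  let ?D = "\<lambda>c j. D (\<lambda>k. c (k - s)) (j - B) - D c j"
  have z: "commutator (twist_group m) x y = (?D, 0, 0, (alt s - 1) * u)"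
    using twist_carrierD(2)[OF X B] twist_carrierD(2)[OF Y B]
    by (simp add: commutator_def inv_twist_group[OF m] X Y x' y'
        twist_inv_def twist_mult_def mod_simps fun_eq_iff algebra_simps)
  have "commutator (twist_group m) x y \<in> twist_carrier m"
    using m_closed inv_closed X y unfolding x' commutator_def by (metis twist_group_simps(1))
  moreover have "2 ^ (Suc n + 1) * m dvd (alt s - 1) * u - 2 * (- 2) ^ Suc n * ?D c j"
    if c: "(fdiff ^^ Suc n) c = alt" for c j
  proof -
    define d where "d k = c (k - s) - c k" for k
    \<comment> \<open>The \<open>t\<close>-sum of \<open>x\<close> is 0, so the telescoped term
      vanishes, and every weight is a difference.\<close>
    have const: "m dvd D b (j + 1) - D b j" for b j
      using twist_carrierD(4)[OF X] fdiff_surj[of b] by (metis diff_self diff_zero)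
    have "m dvd D b (j + k) - D b j" for b k
    proof (induction k rule: int_induct[of _ 0])
      case (step1 i)
      then show ?case using dvd_add[OF const[of b "j + i"] step1(2)] by (simp add: add.assoc)
    next
      case (step2 i)
      then show ?case using dvd_diff[OF step2(2) const[of b "j + (i - 1)"]] by simp
    qed simp
    from this[of _ "- B"] have shift: "m dvd D b (j - B) - D b j" for b
      by simp
    have "D (\<lambda>k. c (k - s)) (j - B) = D d (j - B) + D c (j - B)"
      using twist_carrierD(3)[OF X, of d c "j - B"] by (simp add: d_def)
    then have "?D c j - D d j = (D d (j - B) - D d j) + (D c (j - B) - D c j)"
      by simp
    then have "m dvd ?D c j - D d j"
      using dvd_add[OF shift[of d] shift[of c]] by (simp only:)
    then obtain q where q: "?D c j = D d j + m * q"
      by (metis dvdE diff_eq_eq add.commute)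
    have e: "fdiff ((fdiff ^^ n) c) = alt"
      using c by simp
    have d: "(fdiff ^^ n) d = (\<lambda>k. if even s then 0 else alt k)"
      unfolding d_def fdiff_pow_diff fdiff_pow_shift using fdiff_eq_alt[OF e] by simp
    have "(- 2 :: int) ^ n = 2 ^ n * alt (int n)"
      by (simp add: alt_def power_minus[of "2 :: int"])
    \<comment> \<open>The error \<open>m * q\<close> is harmless, since its coefficient supplies the
      whole power of 2.\<close>
    then have mq: "2 ^ (Suc n + 1) * m dvd 4 * (- 2) ^ n * (m * q)"
      by (intro dvdI[of _ _ "alt (int n) * q"]) simp
    show ?thesis
    proof (cases "even s")
      case True
      have c': "(fdiff ^^ n) (fdiff c) = alt"
        using c by (simp add: funpow_swap1)
      \<comment> \<open>The \<open>n\<close>-fold difference of \<open>d\<close> is 0, so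
        \<open>fdiff c\<close> and \<open>fdiff c + d\<close> are both admissible for
        \<open>x\<close>; subtracting the two divisibilities isolates \<open>D d j\<close>.\<close>
      moreover from this have "(fdiff ^^ n) (\<lambda>k. fdiff c k + d k) = alt"
        using d True unfolding fdiff_pow_add by simp
      ultimately have "2 ^ (n + 1) * m dvd
          (u - 2 * (- 2) ^ n * D (fdiff c) j) - (u - 2 * (- 2) ^ n * D (\<lambda>k. fdiff c k + d k) j)"
        by (intro dvd_diff layer)
      then have "2 ^ (n + 1) * m dvd 2 * (- 2) ^ n * D d j"
        by (simp add: twist_carrierD(3)[OF X] algebra_simps)
      then have "2 ^ (Suc n + 1) * m dvd 2 * (2 * (- 2) ^ n * D d j)"
        using mult_dvd_mono[OF dvd_refl[of "2 :: int"]] by (simp add: mult.assoc)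
      moreover have "(alt s - 1) * u - 2 * (- 2) ^ Suc n * ?D c j
          = 2 * (2 * (- 2) ^ n * D d j) + 4 * (- 2) ^ n * (m * q)"
        unfolding q using True by (simp add: alt_def algebra_simps)
      ultimately show ?thesis
        using mq by (metis dvd_add)
    next
      case False
      then have "(fdiff ^^ n) d = alt"
        using d by (simp add: fun_eq_iff)
      then have "2 ^ (Suc n + 1) * m dvd - (2 * (u - 2 * (- 2) ^ n * D d j))"
        using mult_dvd_mono[OF dvd_refl[of "2 :: int"] layer[of d j]] unfolding dvd_minus_iff
        by (simp add: mult.assoc)
      moreover have "(alt s - 1) * u - 2 * (- 2) ^ Suc n * ?D c j
          = - (2 * (u - 2 * (- 2) ^ n * D d j)) + 4 * (- 2) ^ n * (m * q)"
        unfolding q using False by (simp add: alt_def algebra_simps)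
      ultimately show ?thesis
        using mq by (metis dvd_add)
    qed
  qed
  ultimately show ?thesis
    unfolding z by (simp add: twist_layer_def)
qed

lemma lower_central_twist_group:
  assumes m: "m > 0"
  shows "lower_central (twist_group m) (Suc (Suc n)) \<subseteq> twist_layer m n"
proof (induction n)
  case 0
  show ?case
    by (rule lower_central_Suc_subset[OF group_twist_group[OF m] subgroup_twist_layer[OF m]])
      (simp add: commutator_twist_layer_0[OF m])
next
  case (Suc n)
  show ?case
  proof (rule lower_central_Suc_subset[OF group_twist_group[OF m] subgroup_twist_layer[OF m]])
    fix x y
    assume "x \<in> lower_central (twist_group m) (Suc (Suc n))" "y \<in> carrier (twist_group m)"
    with Suc show "commutator (twist_group m) x y \<in> twist_layer m (Suc n)"
      by (intro commutator_twist_layer_Suc[OF m]) (auto simp only: twist_group_simps)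
  qed
qed

section \<open>Powers of \<open>a\<close> in the lower central terms\<close>

text \<open>\<open>r\<close> is the corrected exponent sum of the image in the twist group, divided
  by \<open>2 ^ (n + 1) * m\<close>. On a power of \<open>a\<close> the correction is 0 and
  \<open>u\<close> is the exponent. The second conclusion serves twice: it gives the value 1 at the
  generator of the cyclic factor and makes a power of \<open>a\<close> with value 0 trivial.\<close>

lemma BS_lower_central_retraction:
  fixes m :: int
  assumes m: "m > 0"
  obtains r :: "(BS_generator \<times> bool) list set \<Rightarrow> int" where
    "\<And>x y. x \<in> lower_central (BS m (- m)) (Suc (Suc n)) \<Longrightarrow> y \<in> lower_central (BS m (- m)) (Suc (Suc n))
      \<Longrightarrow> r (x \<otimes>\<^bsub>BS m (- m)\<^esub> y) = r x + r y"
    "\<And>k. BS_elem_a m (- m) [^]\<^bsub>BS m (- m)\<^esub> (k :: int) \<in> lower_central (BS m (- m)) (Suc (Suc n))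
      \<Longrightarrow> k = 2 ^ (n + 1) * m * r (BS_elem_a m (- m) [^]\<^bsub>BS m (- m)\<^esub> k)"
proof -
  let ?G = "BS m (- m)" and ?H = "twist_group m"
  interpret G: group ?G by (rule group_BS)
  interpret H: group ?H by (rule group_twist_group[OF m])
  let ?a = "BS_elem_a m (- m)"
  define a :: twist where "a = (\<lambda>c j. 0, 1, 0, 1)"
  \<comment> \<open>A single letter \<open>t\<close> read at \<open>a\<close>-position
    \<open>j\<close> and \<open>t\<close>-position 0 contributes the reduced position times the
    weight \<open>c 0\<close>.\<close>
  define t :: twist where "t = (\<lambda>c j. (j mod m) * c 0, 0, 1, 0)"
  have a: "a \<in> carrier ?H"
    using m by (auto simp: a_def twist_carrier_def)
  have t: "t \<in> carrier ?H"
  proof -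
    have "m dvd (j + 1) mod m * z - j mod m * z - z" for j z
    proof -
      have "m dvd (j + 1) mod m - j mod m - 1"
        by (simp add: mod_eq_dvd_iff[symmetric] mod_simps)
      then have "m dvd ((j + 1) mod m - j mod m - 1) * z"
        by (rule dvd_mult2)
      then show ?thesis by (simp add: algebra_simps)
    qed
    from this[of _ "b 1 - b 0" for b :: "int \<Rightarrow> int"]
    have "m dvd (j + 1) mod m * fdiff b 0 - j mod m * fdiff b 0 - (b 1 - b 0)" for j b
      by (simp add: fdiff_def)
    moreover have "2 * m dvd j + j - 2 * (j mod m)" for j
    proof -
      have "2 * m dvd 2 * (j - j mod m)"
        by (rule mult_dvd_mono) (simp_all add: dvd_minus_mod)
      then show ?thesis by (simp add: algebra_simps)
    qed
    moreover have "j mod m = j' mod m" if "m dvd j - j'" for j j'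
      using that by (simp add: mod_eq_dvd_iff)
    ultimately show ?thesis
      using m by (auto simp: t_def twist_carrier_def algebra_simps)
  qed
  have a_nat: "a [^]\<^bsub>?H\<^esub> k = (\<lambda>c j. 0, int k mod (2 * m), 0, int k)" for k :: nat
    by (induction k) (auto simp: a_def twist_mult_def mod_simps add.commute)
  have a_pow: "a [^]\<^bsub>?H\<^esub> k = (\<lambda>c j. 0, k mod (2 * m), 0, k)" for k :: int
  proof (cases k)
    case (nonneg i)
    then show ?thesis using a_nat[of i] by (simp add: int_pow_int)
  next
    case (neg i)
    have "a [^]\<^bsub>?H\<^esub> k = inv\<^bsub>?H\<^esub> (a [^]\<^bsub>?H\<^esub> Suc i)"
      unfolding neg by (rule H.int_pow_neg_int[OF a])
    also have "\<dots> = twist_inv m (a [^]\<^bsub>?H\<^esub> Suc i)"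
      using H.nat_pow_closed[OF a, of "Suc i"]
      by (intro inv_twist_group[OF m]) (simp only: twist_group_simps)
    finally show ?thesis
      by (simp only: a_nat) (simp add: twist_inv_def neg mod_simps)
  qed
  \<comment> \<open>This matches the \<open>A\<close>-components of the relation. In the others,
    conjugation by \<open>t\<close> flips the sign of \<open>u\<close>, and the contributions of
    \<open>t\<close> and its inverse to \<open>D\<close> cancel because their positions differ by
    \<open>m\<close>.\<close>
  have "m mod (2 * m) = (- m) mod (2 * m)"
    unfolding mod_eq_dvd_iff by simp
  then have rel: "inv\<^bsub>?H\<^esub> t \<otimes>\<^bsub>?H\<^esub> a [^]\<^bsub>?H\<^esub> m \<otimes>\<^bsub>?H\<^esub> t = a [^]\<^bsub>?H\<^esub> (- m)"
    using m t unfolding a_pow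
    by (simp add: inv_twist_group) (simp add: t_def twist_inv_def twist_mult_def fun_eq_iff mod_simps)
  obtain F where F: "F \<in> hom ?G ?H" "F ?a = a"
    by (rule H.BS_hom[OF a t rel]) blast
  interpret F: group_hom ?G ?H F
    by unfold_locales (rule F(1))
  let ?L = "lower_central ?G (Suc (Suc n))"
  have L: "x \<in> carrier ?G" "F x \<in> twist_layer m n" if "x \<in> ?L" for x
    using that lower_central_subset[OF G.is_group, of "Suc (Suc n)"]
      F.lower_central_image_subset[of "Suc (Suc n)"] lower_central_twist_group[OF m, of n]
    by (auto simp del: lower_central.simps)
  obtain c where c: "(fdiff ^^ n) c = alt"
    using fdiff_pow_surj by blast
  \<comment> \<open>The division is exact on \<open>twist_layer m n\<close>, hence additive
    there.\<close>
  define \<rho> :: "twist \<Rightarrow> int"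
    where "\<rho> = (\<lambda>(D, A, s, u). (u - 2 * (- 2) ^ n * D c 0) div (2 ^ (n + 1) * m))"
  show thesis
  proof (rule that[of "\<rho> \<circ> F"])
    fix x y assume xy: "x \<in> ?L" "y \<in> ?L"
    obtain D u where x: "F x = (D, 0, 0, u)"
      using L(2)[OF xy(1)] by (auto simp: twist_layer_def)
    obtain E v where y: "F y = (E, 0, 0, v)"
      using L(2)[OF xy(2)] by (auto simp: twist_layer_def)
    have "2 ^ (n + 1) * m dvd u - 2 * (- 2) ^ n * D c 0"
      using L(2)[OF xy(1)] c unfolding x twist_layer_def by blast
    then have "(u - 2 * (- 2) ^ n * D c 0 + (v - 2 * (- 2) ^ n * E c 0)) div (2 ^ (n + 1) * m)
        = \<rho> (F x) + \<rho> (F y)"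
      by (simp add: x y \<rho>_def div_plus_div_distrib_dvd_left)
    moreover have "F (x \<otimes>\<^bsub>?G\<^esub> y) = (\<lambda>c j. D c j + E c j, 0, 0, u + v)"
      using L xy by (simp add: x y twist_mult_def)
    ultimately show "(\<rho> \<circ> F) (x \<otimes>\<^bsub>?G\<^esub> y) = (\<rho> \<circ> F) x + (\<rho> \<circ> F) y"
      by (simp add: \<rho>_def algebra_simps)
  next
    fix k :: int assume k: "?a [^]\<^bsub>?G\<^esub> k \<in> ?L"
    have Fk: "F (?a [^]\<^bsub>?G\<^esub> k) = (\<lambda>c j. 0, k mod (2 * m), 0, k)"
      using F.hom_int_pow[OF BS_elem_a_closed, of k] by (simp add: F(2) a_pow)
    then have "2 ^ (n + 1) * m dvd k"
      using L(2)[OF k] c by (auto simp: twist_layer_def)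
    then show "k = 2 ^ (n + 1) * m * (\<rho> \<circ> F) (?a [^]\<^bsub>?G\<^esub> k)"
      by (simp add: Fk \<rho>_def)
  qed
qed

text \<open>Conjugation by \<open>t\<close> inverts these powers of \<open>a\<close>, so the
  commutator of such a power with \<open>t\<close> is its inverse square: the exponent doubles in
  absolute value while the index rises by one.\<close>

lemma BS_power_in_lower_central:
  fixes m :: int
  shows "BS_elem_a m (- m) [^]\<^bsub>BS m (- m)\<^esub> (2 ^ n * m) \<in> lower_central (BS m (- m)) (Suc n)"
proof -
  let ?G = "BS m (- m)" and ?a = "BS_elem_a m (- m)" and ?t = "BS_elem_t m (- m)"
  interpret group ?G by (rule group_BS)
  note [simp] = BS_elem_a_closed[of m "- m"] BS_elem_t_closed[of m "- m"]
  have conj: "inv\<^bsub>?G\<^esub> ?t \<otimes>\<^bsub>?G\<^esub> ?a [^]\<^bsub>?G\<^esub> (2 ^ n * m) \<otimes>\<^bsub>?G\<^esub> ?t = ?a [^]\<^bsub>?G\<^esub> (- (2 ^ n * m))" for n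
  proof (induction n)
    case 0
    then show ?case using BS_relation[of m "- m"] by simp
  next
    case (Suc n)
    let ?b = "?a [^]\<^bsub>?G\<^esub> (2 ^ n * m)"
    have "?a [^]\<^bsub>?G\<^esub> (2 ^ Suc n * m) = ?b \<otimes>\<^bsub>?G\<^esub> ?b"
      by (simp add: algebra_simps flip: int_pow_mult)
    moreover have "?t \<otimes>\<^bsub>?G\<^esub> (inv\<^bsub>?G\<^esub> ?t \<otimes>\<^bsub>?G\<^esub> z) = z" if "z \<in> carrier ?G" for z
      using that by (simp flip: m_assoc)
    ultimately have "inv\<^bsub>?G\<^esub> ?t \<otimes>\<^bsub>?G\<^esub> ?a [^]\<^bsub>?G\<^esub> (2 ^ Suc n * m) \<otimes>\<^bsub>?G\<^esub> ?t
        = (inv\<^bsub>?G\<^esub> ?t \<otimes>\<^bsub>?G\<^esub> ?b \<otimes>\<^bsub>?G\<^esub> ?t) \<otimes>\<^bsub>?G\<^esub> (inv\<^bsub>?G\<^esub> ?t \<otimes>\<^bsub>?G\<^esub> ?b \<otimes>\<^bsub>?G\<^esub> ?t)"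
      by (simp add: m_assoc)
    also have "\<dots> = ?a [^]\<^bsub>?G\<^esub> (- (2 ^ Suc n * m))"
      unfolding Suc by (simp add: algebra_simps flip: int_pow_mult)
    finally show ?case .
  qed
  show ?thesis
  proof (induction n)
    case (Suc n)
    let ?k = "2 ^ n * m"
    let ?b = "?a [^]\<^bsub>?G\<^esub> ?k"
    have "commutator ?G ?b ?t = inv\<^bsub>?G\<^esub> ?b \<otimes>\<^bsub>?G\<^esub> (inv\<^bsub>?G\<^esub> ?t \<otimes>\<^bsub>?G\<^esub> ?b \<otimes>\<^bsub>?G\<^esub> ?t)"
      by (simp add: commutator_def m_assoc)
    also have "\<dots> = ?a [^]\<^bsub>?G\<^esub> (- ?k) \<otimes>\<^bsub>?G\<^esub> ?a [^]\<^bsub>?G\<^esub> (- ?k)"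
      by (simp only: conj) (simp add: int_pow_neg)
    also have "\<dots> = ?a [^]\<^bsub>?G\<^esub> (- (2 ^ Suc n * m))"
      by (simp add: algebra_simps flip: int_pow_mult)
    finally have "inv\<^bsub>?G\<^esub> (commutator ?G ?b ?t) = ?a [^]\<^bsub>?G\<^esub> (2 ^ Suc n * m)"
      by (simp add: int_pow_neg)
    moreover have "commutator ?G ?b ?t \<in> lower_central ?G (Suc (Suc n))"
      unfolding lower_central.simps commutator_subgroup_def
      by (rule generate.incl) (use Suc BS_elem_t_closed in blast)
    ultimately show ?case
      using subgroup.m_inv_closed[OF subgroup_lower_central[OF is_group]] by metis
  qed simp
qed

text \<open>When both exponents in the relation are \<open>m\<close>, it allows a homomorphism to
  the integers with \<open>a\<close> mapped to 1 and \<open>t\<close> to 0. It kills the terms of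
  index at least 2 and returns the exponent of a power of \<open>a\<close>.\<close>

lemma BS_lower_central_Int_powers:
  fixes m k :: int
  assumes "m \<noteq> 0" "BS_elem_a m m [^]\<^bsub>BS m m\<^esub> k \<in> lower_central (BS m m) i" "i > 1"
  shows "k = 0"
proof -
  interpret G: group "BS m m" by (rule group_BS)
  interpret Z: comm_group integer_group by (rule abelian_integer_group)
  obtain F where F: "F \<in> hom (BS m m) integer_group" "F (BS_elem_a m m) = 1"
    using Z.BS_hom[of 1 0 m m] by auto
  interpret F: group_hom "BS m m" integer_group F
    by unfold_locales (rule F(1))
  have "lower_central integer_group (Suc (Suc 0)) \<subseteq> {0}"
  proof (rule lower_central_Suc_subset[OF group_integer_group])
    show "subgroup {0} integer_group"
      using Z.triv_subgroup by simp
  qed (simp add: commutator_def)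
  moreover have "lower_central integer_group i \<subseteq> lower_central integer_group (Suc (Suc 0))"
    using assms(3) by (intro lower_central_antimono) auto
  ultimately have "F (BS_elem_a m m [^]\<^bsub>BS m m\<^esub> k) = 0"
    using F.lower_central_image_subset[of i] assms(2) by blast
  then show ?thesis
    using F.hom_int_pow[OF BS_elem_a_closed, of k] F(2) by simp
qed

section \<open>Both isomorphisms, from the projection and its kernel\<close>

theorem proposition2:
  fixes m i :: nat
  assumes "m > 1" and "i > 1"
  shows "gamma i (BS (int m) (int m))
           \<cong> gamma i (free_product integer_group (integer_mod_group m))
       \<and> gamma i (BS (int m) (- int m))
           \<cong> subgroup_generated (BS (int m) (- int m))
               {BS_elem_a (int m) (- int m) [^]\<^bsub>BS (int m) (- int m)\<^esub> (2 ^ (i - 1) * m)}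
             \<times>\<times> gamma i (free_product integer_group (integer_mod_group m))"
proof
  let ?Q = "free_product integer_group (integer_mod_group m)"
  let ?P = "BS (int m) (int m)" and ?N = "BS (int m) (- int m)"
  obtain p where p: "group_hom ?P ?Q p" "p ` carrier ?P = carrier ?Q"
    "\<And>g. g \<in> carrier ?P \<Longrightarrow> p g = \<one>\<^bsub>?Q\<^esub> \<Longrightarrow>
      \<exists>k :: int. g = BS_elem_a (int m) (int m) [^]\<^bsub>?P\<^esub> (int m * k)"
    by (rule BS_projection[OF assms(1), of 1 "int m"]) (simp, simp, blast)
  show "gamma i ?P \<cong> gamma i ?Q"
  proof (rule group_hom.gamma_iso[OF p(1,2)])
    fix x assume x: "x \<in> lower_central ?P i" "p x = \<one>\<^bsub>?Q\<^esub>"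
    then obtain k :: int where k: "x = BS_elem_a (int m) (int m) [^]\<^bsub>?P\<^esub> (int m * k)"
      using p(3) lower_central_subset[OF group_BS] by blast
    then have "int m * k = 0"
      using x(1) assms by (intro BS_lower_central_Int_powers[of "int m" _ i]) auto
    then show "x = \<one>\<^bsub>?P\<^esub>"
      unfolding k by (simp only: int_pow_0)
  qed
  let ?a = "BS_elem_a (int m) (- int m)"
  interpret N: group ?N by (rule group_BS)
  have e: "(- 1 :: int) = 1 \<or> (- 1 :: int) = - 1" "- int m = - 1 * int m"
    by simp_all
  obtain q where q: "group_hom ?N ?Q q" "q ` carrier ?N = carrier ?Q"
    "q (?a [^]\<^bsub>?N\<^esub> int m) = \<one>\<^bsub>?Q\<^esub>"
    "\<And>g. g \<in> carrier ?N \<Longrightarrow> q g = \<one>\<^bsub>?Q\<^esub> \<Longrightarrow> \<exists>k :: int. g = ?a [^]\<^bsub>?N\<^esub> (int m * k)"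
    by (rule BS_projection[OF assms(1) e that])
  interpret q: group_hom ?N ?Q q by (rule q(1))
  obtain n where n: "i = Suc (Suc n)"
    using assms(2) by (auto dest: less_imp_Suc_add)
  obtain r :: "_ \<Rightarrow> int" where r:
    "\<And>x y. x \<in> lower_central ?N i \<Longrightarrow> y \<in> lower_central ?N i \<Longrightarrow> r (x \<otimes>\<^bsub>?N\<^esub> y) = r x + r y"
    "\<And>k. ?a [^]\<^bsub>?N\<^esub> k \<in> lower_central ?N i \<Longrightarrow> k = 2 ^ (n + 1) * int m * r (?a [^]\<^bsub>?N\<^esub> k)"
    unfolding n by (rule BS_lower_central_retraction[of "int m" n]) (use assms(1) in auto)
  let ?c = "?a [^]\<^bsub>?N\<^esub> (2 ^ (i - 1) * m)"
  \<comment> \<open>The exponent in the statement is a natural number, while the facts on powers of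
    \<open>a\<close> use integers; \<open>i - 1\<close> is \<open>n + 1\<close>.\<close>
  have c: "?c = ?a [^]\<^bsub>?N\<^esub> (2 ^ (n + 1) * int m)"
    using int_pow_int[of ?N ?a "2 ^ (i - 1) * m"] by (simp add: n)
  have c_mem: "?c \<in> lower_central ?N i"
    using BS_power_in_lower_central[of "int m" "n + 1"] unfolding c by (simp only: n Suc_eq_plus1)
  show "gamma i ?N \<cong> subgroup_generated ?N {?c} \<times>\<times> gamma i ?Q"
  proof (rule q.gamma_iso_DirProd[OF q(2) _ r(1) c_mem])
    show "q ?c = \<one>\<^bsub>?Q\<^esub>"
    proof -
      have "?c = (?a [^]\<^bsub>?N\<^esub> int m) [^]\<^bsub>?N\<^esub> (2 ^ (n + 1) :: int)"
        unfolding c using N.int_pow_pow[OF BS_elem_a_closed, of "int m" "2 ^ (n + 1)"]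
        by (simp add: mult.commute)
      then show ?thesis
        using q.hom_int_pow[of "?a [^]\<^bsub>?N\<^esub> int m"] BS_elem_a_closed[of "int m" "- int m"] q(3) by simp
    qed
    \<comment> \<open>The formula for \<open>r\<close> at \<open>?c\<close> itself; cancelling the
      nonzero factor leaves the value 1.\<close>
    have "2 ^ (n + 1) * int m = 2 ^ (n + 1) * int m * r ?c"
      using r(2) c_mem unfolding c by blast
    then show "r ?c = 1"
      using assms(1) by simp
    fix x assume x: "x \<in> lower_central ?N i" "q x = \<one>\<^bsub>?Q\<^esub>" "r x = 0"
    then obtain k :: int where k: "x = ?a [^]\<^bsub>?N\<^esub> (int m * k)"
      using q(4) lower_central_subset[OF group_BS] by blast
    \<comment> \<open>By \<open>r(2)\<close> the exponent is a multiple of \<open>r x\<close>, which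
      is 0.\<close>
    then have "int m * k = 0"
      using r(2)[of "int m * k"] x by simp
    then show "x = \<one>\<^bsub>?N\<^esub>"
      unfolding k by (simp only: int_pow_0)
  qed
qed

end
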